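(* Let $\{W_i\}_{i=1}^n$ be entanglement witnesses on $\mathscr{H}=\bigotimes_{k=1}^m\mathbb{C}^{d_k}$, let $W=\sum_{i=1}^nW_i$, and suppose that the smallest eigenvalue $\epsilon$ of $W$ satisfies $\epsilon>0$. Let $\lambda_i$ be the largest eigenvalue of $W_i$ for each $i$, and $\lambda=\sum_{i=1}^n\lambda_i$. Let $\mathscr{E}=\{\eta_i,\rho_i\}_{i=1}^n$ be the quantum state ensemble with $$\eta_i=\frac{\operatorname{Tr}(\lambda_iW-\epsilon W_i)}{\operatorname{Tr}(\lambda W-\epsilon W)},\qquad \rho_i=\frac{\lambda_iW-\epsilon W_i}{\operatorname{Tr}(\lambda_iW-\epsilon W_i)},\qquad i=1,\ldots,n.$$ For each $j$, let $\delta_j$ be the absolute value of the smallest (negative) eigenvalue of $\sqrt{W}^{-1}W_j\sqrt{W}^{-1}$. Then for every $j=1,\ldots,n$, $$\mathcal{Q}_j(\mathscr{E})\leqslant\frac{\lambda_j}{\lambda-\epsilon}<\mathcal{C}_j(\mathscr{E})=\frac{\lambda_j+\epsilon\delta_j}{\lambda-\epsilon}.$$ In particular, the maximum confidence of measurements to identify $\rho_j$ is nonlocal, i.e. $\mathcal{L}_j(\mathscr{E})<\mathcal{C}_j(\mathscr{E})$, for every $j=1,\ldots,n$. Moreover, if $W_j$ is a weakly-optimal entanglement witness, then $\mathcal{Q}_j(\mathscr{E})=\dfrac{\lambda_j}{\lambda-\epsilon}$.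
   Context: Let $\mathscr{H}=\bigotimes_{k=1}^m\mathbb{C}^{d_k}$ with $m\geqslant 2$ and positive integers $d_1,\ldots,d_m$. $\mathbb{H}$ is the set of Hermitian operators on $\mathscr{H}$, and $\mathbb{H}_+\subseteq\mathbb{H}$ is the set of positive-semidefinite ones; $\sqrt{W}$ is the positive square root of a positive-semidefinite $W$. A state is $\rho\in\mathbb{H}_+$ with $\operatorname{Tr}\rho=1$. An ensemble $\{\eta_i,\rho_i\}_{i=1}^n$ consists of states $\rho_i$ with nonzero probabilities $\eta_i$ (so $\eta_i>0$, $\sum_i\eta_i=1$), and $\rho_0=\sum_{i=1}^n\eta_i\rho_i$. An operator $E\in\mathbb{H}_+$ is separable if $E=\sum_l p_l\bigotimes_{k=1}^m\sigma_l^{(k)}$ with $p_l\geqslant 0$ and $\sigma_l^{(k)}$ states on $\mathbb{C}^{d_k}$; $\mathbb{SEP}$ is the set of all separable operators. A separable state is an element of $\mathbb{SEP}$ of trace $1$. An operator $E\in\mathbb{H}$ is block positive if $\operatorname{Tr}(EF)\geqslant0$ for all $F\in\mathbb{SEP}$; $\mathbb{SEP}^*$ is the set of all block-positive operators. An entanglement witness is an element of $\mathbb{SEP}^*\setminus\mathbb{H}_+$; an entanglement witness $V$ is weakly optimal if there is a separable state $\sigma$ with $\operatorname{Tr}(\sigma V)=0$. A measurement is a family $\mathscr{M}=\{M_i\}_{i=0}^n\subseteq\mathbb{H}_+$ with $\sum_iM_i=\mathbb{1}$. It is an LOCC measurement if it can be realized by local operations and classical communication, i.e. by a protocol in which the $m$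 parties perform local quantum operations and measurements on their own subsystems (possibly using randomness and depending on previously communicated messages), exchange classical messages, and determine the final outcome from the classical record. Every LOCC measurement has all $M_i\in\mathbb{SEP}$. When $\operatorname{Tr}(\rho_0M_j)\neq0$, the confidence to identify $\rho_j$ is $\Pr(\rho_j|M_j)=\dfrac{\eta_j\operatorname{Tr}(\rho_jM_j)}{\operatorname{Tr}(\rho_0M_j)}$. $\mathcal{C}_j(\mathscr{E})$ (resp. $\mathcal{L}_j(\mathscr{E})$) is the maximum of $\Pr(\rho_j|M_j)$ over all measurements (resp. all LOCC measurements) with $\operatorname{Tr}(\rho_0M_j)\neq0$. The maximum confidence to identify $\rho_j$ is called nonlocal if $\mathcal{L}_j(\mathscr{E})<\mathcal{C}_j(\mathscr{E})$. $\mathcal{Q}_j(\mathscr{E})=\min\{q\in\mathbb{R}\mid q\rho_0-\eta_j\rho_j\in\mathbb{SEP}^*\}$. *)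

theory Defs
  imports
    Complex_Main
    "Jordan_Normal_Form.Schur_Decomposition"
    "Jordan_Normal_Form.Gauss_Jordan_Elimination"
    "Jordan_Normal_Form.Char_Poly"
begin

section \<open>Operators on a multipartite space\<close>

text \<open>
  A multipartite space with \<open>m\<close> parties is given by the list \<open>d\<close> of its \<open>m\<close> local dimensions.
  Operators are complex matrices of size \<open>prod_list d\<close>, the tensor product being the
  Kronecker product. Families indexed by \<open>1..n\<close> or \<open>0..n\<close> are functions on \<open>nat\<close> whose other
  values are irrelevant.
\<close>

text \<open>The type of matrices has no global zero, so \<open>sum\<close> is not available on it.\<close>

definition msum :: "nat \<Rightarrow> ('i \<Rightarrow> complex mat) \<Rightarrow> 'i set \<Rightarrow> complex mat" where
  "msum N f I = mat N N (\<lambda>(a, b). \<Sum>i\<in>I. f i $$ (a, b))"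

definition tr :: "complex mat \<Rightarrow> complex" where
  "tr A = (\<Sum>i<dim_row A. A $$ (i, i))"

definition kron :: "complex mat \<Rightarrow> complex mat \<Rightarrow> complex mat" where
  "kron A B = mat (dim_row A * dim_row B) (dim_col A * dim_col B)
     (\<lambda>(i, j). A $$ (i div dim_row B, j div dim_col B) * B $$ (i mod dim_row B, j mod dim_col B))"

definition tensor :: "complex mat list \<Rightarrow> complex mat" where
  "tensor As = foldr kron As (1\<^sub>m 1)"

definition herm :: "nat \<Rightarrow> complex mat set" where
  "herm N = {A \<in> carrier_mat N N. mat_adjoint A = A}"

definition psd :: "nat \<Rightarrow> complex mat set" where
  "psd N = {A \<in> herm N. \<forall>v \<in> carrier_vec N. 0 \<le> Re ((A *\<^sub>v v) \<bullet>c v)}"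

definition states :: "nat \<Rightarrow> complex mat set" where
  "states N = {A \<in> psd N. tr A = 1}"

definition psd_sqrt :: "complex mat \<Rightarrow> complex mat" where
  "psd_sqrt A = (THE S. S \<in> psd (dim_row A) \<and> S * S = A)"

definition minv :: "complex mat \<Rightarrow> complex mat" where
  "minv A = the (mat_inverse A)"

text \<open>The next two are meant for Hermitian matrices, all of whose eigenvalues are real.\<close>

definition min_eig :: "complex mat \<Rightarrow> real" where
  "min_eig A = Min {x. eigenvalue A (complex_of_real x)}"

definition max_eig :: "complex mat \<Rightarrow> real" where
  "max_eig A = Max {x. eigenvalue A (complex_of_real x)}"

section \<open>Separability and entanglement witnesses\<close>

definition SEP :: "nat list \<Rightarrow> complex mat set" where
  "SEP d = {E. \<exists>(r::nat) (p :: nat \<Rightarrow> real) (\<sigma> :: nat \<Rightarrow> nat \<Rightarrow> complex mat).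
     (\<forall>l<r. 0 \<le> p l \<and> (\<forall>k<length d. \<sigma> l k \<in> states (d ! k))) \<and>
     E = msum (prod_list d)
           (\<lambda>l. complex_of_real (p l) \<cdot>\<^sub>m tensor (map (\<sigma> l) [0..<length d])) {..<r}}"

text \<open>
  For Hermitian \<open>E\<close> and \<open>F\<close> the trace of \<open>E * F\<close> is real, so taking \<open>Re\<close> here and below
  only changes the type.
\<close>

definition block_positive :: "nat list \<Rightarrow> complex mat set" where
  "block_positive d = {E \<in> herm (prod_list d). \<forall>F \<in> SEP d. 0 \<le> Re (tr (E * F))}"

definition witnesses :: "nat list \<Rightarrow> complex mat set" where
  "witnesses d = block_positive d - psd (prod_list d)"

definition weakly_optimal :: "nat list \<Rightarrow> complex mat \<Rightarrow> bool" where
  "weakly_optimal d V \<longleftrightarrow> V \<in> witnesses d \<and> (\<exists>\<sigma> \<in> SEP d. tr \<sigma> = 1 \<and> tr (\<sigma> * V) = 0)"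

section \<open>Measurements and LOCC measurements\<close>

definition measurement :: "nat list \<Rightarrow> nat \<Rightarrow> (nat \<Rightarrow> complex mat) \<Rightarrow> bool" where
  "measurement d n M \<longleftrightarrow>
     (\<forall>i\<in>{0..n}. M i \<in> psd (prod_list d)) \<and> msum (prod_list d) M {0..n} = 1\<^sub>m (prod_list d)"

text \<open>
  A quantum instrument on a system of dimension \<open>D\<close> with classical outcomes \<open>x < r\<close>: outcome
  \<open>x\<close> is the completely positive map with Kraus operators \<open>K x y\<close>, \<open>y < s x\<close>, into a system of
  dimension \<open>e x\<close>. As this dimension may differ from \<open>D\<close>, local ancillas are covered; as
  the Kraus operators may be multiples of isometries, so is randomness.
\<close>

definition instrument ::
  "nat \<Rightarrow> nat \<Rightarrow> (nat \<Rightarrow> nat) \<Rightarrow> (nat \<Rightarrow> nat) \<Rightarrow> (nat \<Rightarrow> nat \<Rightarrow> complex mat) \<Rightarrow> bool" where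
  "instrument D r e s K \<longleftrightarrow>
     (\<forall>x<r. 0 < e x \<and> (\<forall>y<s x. K x y \<in> carrier_mat (e x) D)) \<and>
     msum D (\<lambda>(x, y). mat_adjoint (K x y) * K x y) (SIGMA x:{..<r}. {..<s x}) = 1\<^sub>m D"

definition on_party :: "nat list \<Rightarrow> nat \<Rightarrow> complex mat \<Rightarrow> complex mat" where
  "on_party d k A = tensor ((map 1\<^sub>m d)[k := A])"

text \<open>
  \<open>locc_realizes n d M\<close>: some LOCC protocol (with finitely many rounds, each with finitely many
  outcomes) started on local dimensions \<open>d\<close> announces \<open>i\<close> with probability \<open>Tr (\<rho> (M i))\<close> for
  every input state \<open>\<rho>\<close>. A protocol either stops and announces a result, or some party \<open>k\<close>
  applies a local instrument, broadcasts the outcome \<open>x\<close>, and the parties go on with a protocol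
  that may depend on \<open>x\<close>. That protocol realizes \<open>N x\<close>, which the Kraus operators of the
  instrument pull back (Heisenberg picture). Since the protocol branches at every outcome, all
  later choices and the announced result are functions of the whole classical record.
\<close>

inductive locc_realizes :: "nat \<Rightarrow> nat list \<Rightarrow> (nat \<Rightarrow> complex mat) \<Rightarrow> bool" for n :: nat where
  announce:
    "i \<le> n \<Longrightarrow>
     locc_realizes n d
       (\<lambda>j. if j = i then 1\<^sub>m (prod_list d) else 0\<^sub>m (prod_list d) (prod_list d))"
| local_round:
    "k < length d \<Longrightarrow> instrument (d ! k) r e s K \<Longrightarrow>
     (\<And>x. x < r \<Longrightarrow> locc_realizes n (d[k := e x]) (N x)) \<Longrightarrow>
     locc_realizes n d
       (\<lambda>j. msum (prod_list d)
          (\<lambda>(x, y). mat_adjoint (on_party d k (K x y)) * N x j * on_party d k (K x y))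
          (SIGMA x:{..<r}. {..<s x}))"

definition locc_measurement :: "nat list \<Rightarrow> nat \<Rightarrow> (nat \<Rightarrow> complex mat) \<Rightarrow> bool" where
  "locc_measurement d n M \<longleftrightarrow>
     measurement d n M \<and> (\<exists>M'. locc_realizes n d M' \<and> (\<forall>i\<in>{0..n}. M i = M' i))"

section \<open>Ensembles and confidences\<close>

definition ensemble :: "nat list \<Rightarrow> nat \<Rightarrow> (nat \<Rightarrow> real) \<Rightarrow> (nat \<Rightarrow> complex mat) \<Rightarrow> bool" where
  "ensemble d n \<eta> \<rho> \<longleftrightarrow>
     (\<forall>i\<in>{1..n}. 0 < \<eta> i \<and> \<rho> i \<in> states (prod_list d)) \<and> (\<Sum>i\<in>{1..n}. \<eta> i) = 1"

definition avg_state ::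
  "nat list \<Rightarrow> nat \<Rightarrow> (nat \<Rightarrow> real) \<Rightarrow> (nat \<Rightarrow> complex mat) \<Rightarrow> complex mat" where
  "avg_state d n \<eta> \<rho> = msum (prod_list d) (\<lambda>i. complex_of_real (\<eta> i) \<cdot>\<^sub>m \<rho> i) {1..n}"

definition confidence ::
  "nat list \<Rightarrow> nat \<Rightarrow> (nat \<Rightarrow> real) \<Rightarrow> (nat \<Rightarrow> complex mat) \<Rightarrow> nat \<Rightarrow> (nat \<Rightarrow> complex mat) \<Rightarrow> real" where
  "confidence d n \<eta> \<rho> j M =
     \<eta> j * Re (tr (\<rho> j * M j)) / Re (tr (avg_state d n \<eta> \<rho> * M j))"

definition max_confidence ::
  "nat list \<Rightarrow> nat \<Rightarrow> (nat \<Rightarrow> real) \<Rightarrow> (nat \<Rightarrow> complex mat) \<Rightarrow> nat \<Rightarrow> real" where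
  "max_confidence d n \<eta> \<rho> j =
     (GREATEST c. \<exists>M. measurement d n M \<and> tr (avg_state d n \<eta> \<rho> * M j) \<noteq> 0 \<and>
        c = confidence d n \<eta> \<rho> j M)"

text \<open>
  The supremum is the maximum whenever the latter exists; the set of finite-round LOCC
  measurements need not be closed.
\<close>

definition locc_max_confidence ::
  "nat list \<Rightarrow> nat \<Rightarrow> (nat \<Rightarrow> real) \<Rightarrow> (nat \<Rightarrow> complex mat) \<Rightarrow> nat \<Rightarrow> real" where
  "locc_max_confidence d n \<eta> \<rho> j =
     Sup {confidence d n \<eta> \<rho> j M | M.
        locc_measurement d n M \<and> tr (avg_state d n \<eta> \<rho> * M j) \<noteq> 0}"

definition nonlocal_confidence ::
  "nat list \<Rightarrow> nat \<Rightarrow> (nat \<Rightarrow> real) \<Rightarrow> (nat \<Rightarrow> complex mat) \<Rightarrow> nat \<Rightarrow> bool" where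
  "nonlocal_confidence d n \<eta> \<rho> j \<longleftrightarrow> locc_max_confidence d n \<eta> \<rho> j < max_confidence d n \<eta> \<rho> j"

definition Q_bound ::
  "nat list \<Rightarrow> nat \<Rightarrow> (nat \<Rightarrow> real) \<Rightarrow> (nat \<Rightarrow> complex mat) \<Rightarrow> nat \<Rightarrow> real" where
  "Q_bound d n \<eta> \<rho> j =
     (LEAST q. complex_of_real q \<cdot>\<^sub>m avg_state d n \<eta> \<rho> - complex_of_real (\<eta> j) \<cdot>\<^sub>m \<rho> j
        \<in> block_positive d)"

end

(*
  Write T for the trace of W. The ensemble is chosen so that its average state is W / T and
  eta_j rho_j = (lam_j W - eps W_j) / ((Lam - eps) T). Hence the confidence of a measurement
  operator M_j is (lam_j - eps Tr(W_j M_j) / Tr(W M_j)) / (Lam - eps). Block positivity of W_j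
  makes the ratio of traces nonnegative when M_j is separable, in particular for LOCC, whereas over
  all positive operators its minimum is the smallest eigenvalue of W^(-1/2) W_j W^(-1/2), which is
  negative because W_j is not positive; it is attained at a multiple of the projection onto
  W^(-1/2) v for an eigenvector v. Local instruments pull product operators back to product
  operators, so LOCC measurements are separable.
*)
theory Submission
  imports Defs "Jordan_Normal_Form.Spectral_Radius"
begin

section \<open>Adjoints and Hermitian matrices\<close>

text \<open>The constants of the ensemble come from a chain of operator inequalities: eps W_j <= eps
  lam_j <= lam_j W, as lam_j bounds W_j above and eps bounds W below. So lam_j W - eps W_j is
  positive; the second inequality uses lam_j > 0, which has to be proved. These operators add up to
  (Lam - eps) W, and comparing traces gives Lam > eps. For q = lam_j / (Lam - eps) the operator q
  rho_0 - eta_j rho_j is exactly a positive multiple of W_j. Therefore this one number bounds both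
  Q_j and the LOCC confidence, and a separable state orthogonal to W_j pins Q_j down. The three
  optima bring different obligations. \<open>LEAST\<close> and \<open>GREATEST\<close> carry
  information only once an extremum is shown to be attained. The LOCC value is a supremum, so a
  strict inequality for each single measurement would not suffice; strictness comes from the uniform
  bound lam_j / (Lam - eps), which lies below C_j by eps delta_j / (Lam - eps).\<close>

lemma mult_index:
  assumes "A \<in> carrier_mat n m" "B \<in> carrier_mat m p" "i < n" "j < p"
  shows "(A * B) $$ (i, j) = (\<Sum>k<m. A $$ (i, k) * B $$ (k, j))"
  using assms by (auto simp: scalar_prod_def lessThan_atLeast0 intro!: sum.cong)

lemma adjoint_dim [simp]:
  "dim_row (mat_adjoint A) = dim_col A" "dim_col (mat_adjoint A) = dim_row A"
  by (auto simp: mat_adjoint_def)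

lemma adjoint_index [simp]:
  "i < dim_col A \<Longrightarrow> j < dim_row A \<Longrightarrow>
    mat_adjoint A $$ (i, j) = cnj (A $$ (j, i))" for A :: "complex mat"
  by (auto simp: mat_adjoint_def mat_of_rows_def)

lemma adjoint_carrier [simp]:
  "A \<in> carrier_mat n m \<Longrightarrow> mat_adjoint A \<in> carrier_mat m n"
  by (metis adjoint_dim carrier_matD carrier_matI)

lemma adjoint_adjoint [simp]: "mat_adjoint (mat_adjoint A) = A" for A :: "complex mat"
  by (rule eq_matI) auto

lemma adjoint_mult:
  fixes A B :: "complex mat"
  assumes "A \<in> carrier_mat n m" "B \<in> carrier_mat m p"
  shows "mat_adjoint (A * B) = mat_adjoint B * mat_adjoint A"
proof (rule eq_matI)
  fix i j assume "i < dim_row (mat_adjoint B * mat_adjoint A)"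
    "j < dim_col (mat_adjoint B * mat_adjoint A)"
  then show "mat_adjoint (A * B) $$ (i, j) = (mat_adjoint B * mat_adjoint A) $$ (i, j)"
    using assms by (auto simp: scalar_prod_def mult.commute intro!: sum.cong)
qed (use assms in auto)

lemma adjoint_add:
  fixes A B :: "complex mat"
  assumes "A \<in> carrier_mat n m" "B \<in> carrier_mat n m"
  shows "mat_adjoint (A + B) = mat_adjoint A + mat_adjoint B"
  using assms by (intro eq_matI) auto

lemma adjoint_smult:
  "mat_adjoint (c \<cdot>\<^sub>m A) = cnj c \<cdot>\<^sub>m mat_adjoint A" for A :: "complex mat"
  by (rule eq_matI) auto

lemma adjoint_one [simp]: "mat_adjoint (1\<^sub>m n) = (1\<^sub>m n :: complex mat)"
  by (rule eq_matI) auto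

lemma adjoint_zero [simp]: "mat_adjoint (0\<^sub>m n m) = (0\<^sub>m m n :: complex mat)"
  by (rule eq_matI) auto

lemma cscalar_prod_adjoint:
  fixes A :: "complex mat"
  assumes "A \<in> carrier_mat n m" "v \<in> carrier_vec m" "w \<in> carrier_vec n"
  shows "(A *\<^sub>v v) \<bullet>c w = v \<bullet>c (mat_adjoint A *\<^sub>v w)"
proof -
  have "(A *\<^sub>v v) \<bullet>c w = (\<Sum>i<n. \<Sum>k<m. A $$ (i, k) * v $ k * cnj (w $ i))"
    using assms by (auto simp: scalar_prod_def lessThan_atLeast0 sum_distrib_right intro!: sum.cong)
  also have "\<dots> = (\<Sum>k<m. \<Sum>i<n. A $$ (i, k) * v $ k * cnj (w $ i))"
    by (rule sum.swap)
  also have "\<dots> = v \<bullet>c (mat_adjoint A *\<^sub>v w)"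
    using assms
    by (auto simp: scalar_prod_def lessThan_atLeast0 sum_distrib_left algebra_simps intro!: sum.cong)
  finally show ?thesis .
qed

lemma herm_carrier: "A \<in> herm N \<Longrightarrow> A \<in> carrier_mat N N"
  by (simp add: herm_def)

lemma herm_adjoint: "A \<in> herm N \<Longrightarrow> mat_adjoint A = A"
  by (simp add: herm_def)

lemma herm_add: "A \<in> herm N \<Longrightarrow> B \<in> herm N \<Longrightarrow> A + B \<in> herm N"
  by (auto simp: herm_def adjoint_add)

lemma herm_smult: "A \<in> herm N \<Longrightarrow> complex_of_real c \<cdot>\<^sub>m A \<in> herm N"
  by (auto simp: herm_def adjoint_smult)

lemma minus_eq_add_smult:
  "A \<in> carrier_mat n m \<Longrightarrow> B \<in> carrier_mat n m \<Longrightarrow>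
    A - B = A + complex_of_real (-1) \<cdot>\<^sub>m B"
  by (rule eq_matI) auto

lemma herm_minus: "A \<in> herm N \<Longrightarrow> B \<in> herm N \<Longrightarrow> A - B \<in> herm N"
  using herm_add[of A N "complex_of_real (-1) \<cdot>\<^sub>m B"] herm_smult[of B N "-1"]
  by (simp add: minus_eq_add_smult[of A N N B] herm_carrier)

lemma herm_one [simp]: "1\<^sub>m N \<in> herm N"
  by (simp add: herm_def)

lemma herm_zero [simp]: "0\<^sub>m N N \<in> herm N"
  by (simp add: herm_def)

lemma herm_congruence:
  assumes "A \<in> herm M" "C \<in> carrier_mat M N"
  shows "mat_adjoint C * A * C \<in> herm N"
proof -
  have A: "A \<in> carrier_mat M M" by (rule herm_carrier[OF assms(1)])
  have "mat_adjoint (mat_adjoint C * A * C) = mat_adjoint C * mat_adjoint (mat_adjoint C * A)"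
    using A assms(2) by (intro adjoint_mult[of _ N M]) auto
  also have "mat_adjoint (mat_adjoint C * A) = A * C"
    using A assms(2) by (subst adjoint_mult[of _ N M _ M]) (auto simp: herm_adjoint[OF assms(1)])
  also have "mat_adjoint C * (A * C) = mat_adjoint C * A * C"
    using A assms(2) by (intro assoc_mult_mat[symmetric]) auto
  finally show ?thesis
    using A assms(2) by (auto simp: herm_def)
qed

section \<open>Quadratic forms\<close>

text \<open>The form of a Hermitian matrix is real, so \<open>Re\<close> only moves it to a linearly
  ordered type.\<close>

definition qform :: "complex mat \<Rightarrow> complex vec \<Rightarrow> real" where
  "qform A v = Re ((A *\<^sub>v v) \<bullet>c v)"

lemma psd_iff_qform:
  "A \<in> psd N \<longleftrightarrow> A \<in> herm N \<and> (\<forall>v \<in> carrier_vec N. 0 \<le> qform A v)"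
  by (simp add: psd_def qform_def)

lemma psd_herm: "A \<in> psd N \<Longrightarrow> A \<in> herm N"
  by (simp add: psd_def)

lemma psd_carrier: "A \<in> psd N \<Longrightarrow> A \<in> carrier_mat N N"
  by (simp add: psd_def herm_def)

lemma qform_add:
  assumes "A \<in> carrier_mat N N" "B \<in> carrier_mat N N" "v \<in> carrier_vec N"
  shows "qform (A + B) v = qform A v + qform B v"
  using assms
  by (simp add: qform_def add_mult_distrib_mat_vec[of _ N N] add_scalar_prod_distrib[of _ N])

lemma qform_smult:
  assumes "A \<in> carrier_mat N N" "v \<in> carrier_vec N"
  shows "qform (complex_of_real c \<cdot>\<^sub>m A) v = c * qform A v"
proof -
  have "(complex_of_real c \<cdot>\<^sub>m A) *\<^sub>v v = complex_of_real c \<cdot>\<^sub>v (A *\<^sub>v v)"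
    using assms by (intro eq_vecI) (auto simp: scalar_prod_def sum_distrib_left mult.assoc)
  then show ?thesis
    using assms by (simp add: qform_def)
qed

lemma qform_minus:
  assumes "A \<in> carrier_mat N N" "B \<in> carrier_mat N N" "v \<in> carrier_vec N"
  shows "qform (A - B) v = qform A v - qform B v"
  using assms
  by (simp add: qform_def minus_mult_distrib_mat_vec[of _ N N] minus_scalar_prod_distrib[of _ N])

lemma qform_congruence:
  assumes "A \<in> carrier_mat M M" "C \<in> carrier_mat M N" "v \<in> carrier_vec N"
  shows "qform (mat_adjoint C * A * C) v = qform A (C *\<^sub>v v)"
proof -
  have "(mat_adjoint C * A * C) *\<^sub>v v = mat_adjoint C *\<^sub>v (A *\<^sub>v (C *\<^sub>v v))"
    using assms assoc_mult_mat_vec[of "mat_adjoint C * A" N M C N v]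
      assoc_mult_mat_vec[of "mat_adjoint C" N M A M "C *\<^sub>v v"]
      mult_carrier_mat[of "mat_adjoint C" N M A M]
    by (simp del: assoc_mult_mat assoc_mult_mat_vec)
  then show ?thesis
    using assms cscalar_prod_adjoint[of "mat_adjoint C" N M "A *\<^sub>v (C *\<^sub>v v)" v]
    by (simp add: qform_def)
qed

lemma qform_one: "v \<in> carrier_vec N \<Longrightarrow> qform (1\<^sub>m N) v = Re (v \<bullet>c v)"
  by (simp add: qform_def)

lemma cscalar_self_sum:
  "v \<in> carrier_vec N \<Longrightarrow> v \<bullet>c v = complex_of_real (\<Sum>i<N. (cmod (v $ i))\<^sup>2)"
  by (auto simp: scalar_prod_def lessThan_atLeast0 complex_norm_square
      simp del: of_real_power intro!: sum.cong)

lemma cscalar_self_nonneg: "0 \<le> Re (v \<bullet>c v)" for v :: "complex vec"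
  using cscalar_self_sum[of v "dim_vec v"] by (auto intro!: sum_nonneg)

lemma cscalar_self_pos:
  fixes v :: "complex vec"
  assumes "v \<in> carrier_vec N" "v \<noteq> 0\<^sub>v N"
  shows "0 < Re (v \<bullet>c v)"
  using conjugate_square_greater_0_vec[OF assms(1)] assms(2) by (auto simp: less_complex_def)

lemma psd_add:
  assumes "A \<in> psd N" "B \<in> psd N" shows "A + B \<in> psd N"
  using assms by (auto simp: psd_iff_qform herm_add qform_add[of _ N] herm_carrier)

lemma psd_smult:
  assumes "A \<in> psd N" "0 \<le> c" shows "complex_of_real c \<cdot>\<^sub>m A \<in> psd N"
  using assms by (auto simp: psd_iff_qform herm_smult qform_smult[of _ N] herm_carrier)

lemma psd_congruence:
  assumes "A \<in> psd M" "C \<in> carrier_mat M N"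
  shows "mat_adjoint C * A * C \<in> psd N"
  using assms by (auto simp: psd_iff_qform herm_congruence qform_congruence[of A M] herm_carrier)

lemma psd_one [simp]: "1\<^sub>m N \<in> psd N"
  by (auto simp: psd_iff_qform qform_one cscalar_self_nonneg)

lemma qform_zero: "v \<in> carrier_vec N \<Longrightarrow> qform (0\<^sub>m N N) v = 0"
  by (auto simp: qform_def scalar_prod_def)

lemma psd_zero [simp]: "0\<^sub>m N N \<in> psd N"
  by (auto simp: psd_iff_qform qform_zero)

lemma psd_gram:
  assumes "C \<in> carrier_mat M N" shows "mat_adjoint C * C \<in> psd N"
  using psd_congruence[OF psd_one assms] assms
  by (simp add: right_mult_one_mat[of "mat_adjoint C" N M])

section \<open>The spectral theorem\<close>

definition real_diag :: "nat \<Rightarrow> (nat \<Rightarrow> real) \<Rightarrow> complex mat" where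
  "real_diag n r = mat n n (\<lambda>(i, j). if i = j then complex_of_real (r i) else 0)"

lemma real_diag_carrier [simp]: "real_diag n r \<in> carrier_mat n n"
  by (simp add: real_diag_def)

lemma real_diag_index:
  "i < n \<Longrightarrow> j < n \<Longrightarrow> real_diag n r $$ (i, j) = (if i = j then complex_of_real (r i) else 0)"
  by (simp add: real_diag_def)

text \<open>Gram-Schmidt leaves the head of the list unchanged, so after normalisation the first
  column is still a multiple of \<open>v\<close>. Applied to an eigenvector, this gives the change
  of basis for the induction in \<open>herm_spectral\<close>.\<close>

lemma unitary_first_column:
  fixes v :: "complex vec"
  assumes v: "v \<in> carrier_vec n" "v \<noteq> 0\<^sub>v n"
  obtains U c where "U \<in> carrier_mat n n" "mat_adjoint U * U = 1\<^sub>m n"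
    "col U 0 = c \<cdot>\<^sub>v v"
proof -
  interpret cof_vec_space n "TYPE(complex)" .
  define b where "b = basis_completion v"
  define ws where "ws = gram_schmidt n b"
  from basis_completion[OF v, folded b_def]
  have b: "distinct b" "\<not> lin_dep (set b)" "set b \<subseteq> carrier_vec n" "hd b = v" "length b = n"
    by auto
  have n: "n \<noteq> 0" using v by auto
  obtain vs where bv: "b = v # vs" using b n by (cases b) auto
  from gram_schmidt_result[OF b(3) b(1) b(2) refl, folded ws_def]
  have ws: "set ws \<subseteq> carrier_vec n" "corthogonal ws" "length ws = n"
    by (auto simp: b)
  have hd: "hd ws = v" using gram_schmidt_hd[OF v(1), of vs, folded bv] by (simp add: ws_def)
  have wi: "ws ! i \<in> carrier_vec n" if "i < n" for i using ws that by auto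
  \<comment> \<open>The vectors \<open>ws\<close> are orthogonal and nonzero but not normalised;
    \<open>a i\<close> is a reciprocal norm.\<close>
  define a where "a i = complex_of_real (1 / sqrt (Re (ws ! i \<bullet>c ws ! i)))" for i
  define U where "U = mat n n (\<lambda>(k, i). a i * ws ! i $ k)"
  have U: "U \<in> carrier_mat n n" by (simp add: U_def)
  have "mat_adjoint U * U = 1\<^sub>m n"
  proof (rule eq_matI)
    fix i j assume "i < dim_row (1\<^sub>m n)" "j < dim_col (1\<^sub>m n)"
    then have ij: "i < n" "j < n" by auto
    have ca: "cnj (a k) = a k" for k by (simp add: a_def)
    have "(mat_adjoint U * U) $$ (i, j) = a i * a j * (ws ! j \<bullet>c ws ! i)"
      using ij wi[OF ij(1)] wi[OF ij(2)] U
      by (subst mult_index[of _ n n _ n])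
        (auto simp: U_def ca scalar_prod_def lessThan_atLeast0 sum_distrib_left algebra_simps
          intro!: sum.cong)
    also have "\<dots> = 1\<^sub>m n $$ (i, j)"
    proof (cases "i = j")
      case True
      let ?q = "Re (ws ! i \<bullet>c ws ! i)"
      have "ws ! i \<bullet>c ws ! i \<noteq> 0" using corthogonalD[OF ws(2)] ij ws(3) by auto
      moreover have q: "ws ! i \<bullet>c ws ! i = complex_of_real ?q"
        using cscalar_self_sum[OF wi[OF ij(1)]] by simp
      ultimately have "?q \<noteq> 0" by (metis of_real_0)
      then have "0 < ?q" using cscalar_self_nonneg[of "ws ! i"] by linarith
      then have "(1 / sqrt ?q) * (1 / sqrt ?q) * ?q = 1"
        by (simp add: field_simps)
      then have "a i * a i * complex_of_real ?q = 1"
        unfolding a_def by (metis of_real_1 of_real_mult)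
      then show ?thesis using True ij q by simp
    next
      case False
      then show ?thesis using corthogonalD[OF ws(2)] ij ws(3) by auto
    qed
    finally show "(mat_adjoint U * U) $$ (i, j) = 1\<^sub>m n $$ (i, j)" .
  qed (use U in auto)
  moreover have "col U 0 = a 0 \<cdot>\<^sub>v v"
  proof -
    have "ws ! 0 = v" using hd n ws(3) by (cases ws) auto
    then show ?thesis using n v by (intro eq_vecI) (auto simp: U_def)
  qed
  ultimately show ?thesis using U that by blast
qed

lemma mult_block_diag:
  fixes A B C D :: "complex mat"
  assumes "A \<in> carrier_mat k k" "B \<in> carrier_mat k k" "C \<in> carrier_mat m m" "D \<in> carrier_mat m m"
  shows "four_block_mat A (0\<^sub>m k m) (0\<^sub>m m k) C * four_block_mat B (0\<^sub>m k m) (0\<^sub>m m k) D =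
    four_block_mat (A * B) (0\<^sub>m k m) (0\<^sub>m m k) (C * D)"
proof -
  have "A * B + 0\<^sub>m k m * 0\<^sub>m m k = A * B" "A * 0\<^sub>m k m + 0\<^sub>m k m * D = 0\<^sub>m k m"
    "0\<^sub>m m k * B + C * 0\<^sub>m m k = 0\<^sub>m m k" "0\<^sub>m m k * 0\<^sub>m k m + C * D = C * D"
    using assms by auto
  then show ?thesis
    using mult_four_block_mat[OF assms(1) zero_carrier_mat zero_carrier_mat assms(3)
        assms(2) zero_carrier_mat zero_carrier_mat assms(4)] by simp
qed

lemma mult_cancel_left_inverse:
  fixes A :: "complex mat"
  assumes "A \<in> carrier_mat n m" "B \<in> carrier_mat m n" "A * B = 1\<^sub>m n" "C \<in> carrier_mat n k"
  shows "A * (B * C) = C"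
  using assms assoc_mult_mat[of A n m B n C k] by simp

lemma unitary_mult:
  fixes U V :: "complex mat"
  assumes "U \<in> carrier_mat n n" "V \<in> carrier_mat n n"
    "mat_adjoint U * U = 1\<^sub>m n" "mat_adjoint V * V = 1\<^sub>m n"
  shows "mat_adjoint (U * V) * (U * V) = 1\<^sub>m n"
proof -
  have "mat_adjoint (U * V) * (U * V) = mat_adjoint V * (mat_adjoint U * (U * V))"
    using assms(1,2)
    by (simp add: adjoint_mult[OF assms(1,2)] assoc_mult_mat[of _ n n _ n _ n])
  also have "mat_adjoint U * (U * V) = V"
    using assms by (intro mult_cancel_left_inverse[of _ n n]) auto
  finally show ?thesis by (simp only: assms)
qed

lemma unitary_right_inverse:
  fixes U :: "complex mat"
  shows "U \<in> carrier_mat n n \<Longrightarrow> mat_adjoint U * U = 1\<^sub>m n \<Longrightarrow> U * mat_adjoint U = 1\<^sub>m n"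
  by (rule mat_mult_left_right_inverse[of "mat_adjoint U" n]) auto

text \<open>Induction on the dimension. A unitary whose first column is an eigenvector clears the
  first column of the matrix below the corner. Hermiticity then clears the first row and makes the
  corner entry real, which leaves a Hermitian block of size one less.\<close>

theorem herm_spectral:
  assumes "A \<in> herm n"
  obtains U r where "U \<in> carrier_mat n n" "mat_adjoint U * U = 1\<^sub>m n"
    "A = U * real_diag n r * mat_adjoint U"
proof -
  have "\<exists>U r. U \<in> carrier_mat n n \<and> mat_adjoint U * U = 1\<^sub>m n \<and>
    A = U * real_diag n r * mat_adjoint U"
    using assms
  proof (induction n arbitrary: A)
    case 0
    then show ?case
      by (intro exI[of _ "1\<^sub>m 0"] exI[of _ "\<lambda>_. 0"]) (auto simp: herm_def intro!: eq_matI)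
  next
    case (Suc m)
    let ?n = "Suc m"
    have A: "A \<in> carrier_mat ?n ?n" by (rule herm_carrier[OF Suc.prems])
    obtain e where "eigenvalue A e"
      using spectrum_non_empty[OF A] by (auto simp: spectrum_def)
    then obtain v where v: "v \<in> carrier_vec ?n" "v \<noteq> 0\<^sub>v ?n" and ev: "A *\<^sub>v v = e \<cdot>\<^sub>v v"
      using A by (auto simp: eigenvalue_def eigenvector_def)
    obtain W c where W: "W \<in> carrier_mat ?n ?n" "mat_adjoint W * W = 1\<^sub>m ?n"
      and col: "col W 0 = c \<cdot>\<^sub>v v"
      using unitary_first_column[OF v] by blast
    have WW: "W * mat_adjoint W = 1\<^sub>m ?n" by (rule unitary_right_inverse[OF W])
    define A' where "A' = mat_adjoint W * A * W"
    have A'h: "A' \<in> herm ?n" unfolding A'_def by (rule herm_congruence[OF Suc.prems W(1)])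
    have A': "A' \<in> carrier_mat ?n ?n" by (rule herm_carrier[OF A'h])
    have Wc: "mat_adjoint W \<in> carrier_mat ?n ?n" using W by simp
    have sym: "A' $$ (i, j) = cnj (A' $$ (j, i))" if "i < ?n" "j < ?n" for i j
      using arg_cong[OF herm_adjoint[OF A'h], of "\<lambda>M. M $$ (i, j)"] that A' by simp
    have AW: "A *\<^sub>v col W 0 = e \<cdot>\<^sub>v col W 0"
      using v ev A by (simp add: col mult_mat_vec smult_smult_assoc mult.commute)
    have "col A' 0 = (mat_adjoint W * A) *\<^sub>v col W 0"
      using W A unfolding A'_def by (intro col_mult2[of _ ?n ?n _ ?n]) auto
    also have "\<dots> = mat_adjoint W *\<^sub>v (A *\<^sub>v col W 0)"
      using W A v col by (intro assoc_mult_mat_vec[of _ ?n ?n _ ?n]) auto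
    also have "\<dots> = e \<cdot>\<^sub>v (mat_adjoint W *\<^sub>v col W 0)"
      unfolding AW using W v col by (intro mult_mat_vec[of _ ?n ?n]) auto
    also have "mat_adjoint W *\<^sub>v col W 0 = col (mat_adjoint W * W) 0"
      using W by (intro col_mult2[symmetric, of _ ?n ?n _ ?n]) auto
    finally have col0: "col A' 0 = e \<cdot>\<^sub>v col (1\<^sub>m ?n) 0" unfolding W(2) .
    have c0: "A' $$ (i, 0) = (if i = 0 then e else 0)" if "i < ?n" for i
      using arg_cong[OF col0, of "\<lambda>w. w $ i"] that A' by auto
    have r0: "A' $$ (0, i) = (if i = 0 then e else 0)" if "i < ?n" for i
      using sym[of 0 i] c0[of i] c0[of 0] sym[of 0 0] that by auto
    have er: "e = complex_of_real (Re e)"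
      using sym[of 0 0] c0[of 0] by (metis Reals_cnj_iff of_real_Re zero_less_Suc)
    define B where "B = mat m m (\<lambda>(i, j). A' $$ (Suc i, Suc j))"
    have "B \<in> herm m"
      unfolding herm_def B_def using sym[symmetric] by (auto intro!: eq_matI)
    from Suc.IH[OF this] obtain V r where V: "V \<in> carrier_mat m m" "mat_adjoint V * V = 1\<^sub>m m"
      and B: "B = V * real_diag m r * mat_adjoint V" by blast
    define E where "E = mat 1 1 (\<lambda>_. e)"
    let ?V = "four_block_mat (1\<^sub>m 1) (0\<^sub>m 1 m) (0\<^sub>m m 1) V"
    let ?V' = "four_block_mat (1\<^sub>m 1) (0\<^sub>m 1 m) (0\<^sub>m m 1) (mat_adjoint V)"
    let ?D = "four_block_mat E (0\<^sub>m 1 m) (0\<^sub>m m 1) (real_diag m r)"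
    \<comment> \<open>The new eigenvalue comes first, followed by those of the block
      \<open>B\<close>.\<close>
    define s where "s i = (case i of 0 \<Rightarrow> Re e | Suc k \<Rightarrow> r k)" for i
    have E: "E \<in> carrier_mat 1 1" by (simp add: E_def)
    have Vc: "?V \<in> carrier_mat ?n ?n" "?V' \<in> carrier_mat ?n ?n" "?D \<in> carrier_mat ?n ?n"
      using four_block_carrier_mat[OF one_carrier_mat[of 1] V(1)]
        four_block_carrier_mat[OF one_carrier_mat[of 1] adjoint_carrier[OF V(1)]]
        four_block_carrier_mat[OF E real_diag_carrier[of m r]] by auto
    have V': "mat_adjoint ?V = ?V'"
      using V Vc by (intro eq_matI) (auto simp: Suc_diff_Suc)
    have D: "?D = real_diag ?n s"
      using er E by (intro eq_matI)
        (auto simp: real_diag_def s_def E_def Suc_diff_Suc split: nat.splits)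
    have "A' = four_block_mat E (0\<^sub>m 1 m) (0\<^sub>m m 1) B"
      using c0 r0 A' E by (intro eq_matI) (auto simp: B_def E_def)
    also have "\<dots> = ?V * ?D * ?V'"
      using V E by (simp add: mult_block_diag[of _ 1] mult_block_diag[of _ "Suc 0"] B)
    finally have A'eq: "A' = ?V * real_diag ?n s * mat_adjoint ?V" unfolding V' D .
    have VV: "mat_adjoint ?V * ?V = 1\<^sub>m ?n"
    proof -
      have "?V' * ?V = four_block_mat (1\<^sub>m 1) (0\<^sub>m 1 m) (0\<^sub>m m 1) (1\<^sub>m m)"
        using V by (simp add: mult_block_diag[of _ 1] mult_block_diag[of _ "Suc 0"])
      also have "\<dots> = 1\<^sub>m ?n" by (intro eq_matI) auto
      finally show ?thesis unfolding V' .
    qed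
    have UU: "mat_adjoint (W * ?V) = mat_adjoint ?V * mat_adjoint W"
      using W Vc by (intro adjoint_mult) auto
    note as = assoc_mult_mat[of _ ?n ?n _ ?n _ ?n] mult_carrier_mat[of _ ?n ?n _ ?n]
    have 1: "mat_adjoint (W * ?V) * (W * ?V) = 1\<^sub>m ?n"
      by (rule unitary_mult[OF W(1) Vc(1) W(2) VV])
    have "A = (W * mat_adjoint W) * A * (W * mat_adjoint W)"
      using A by (simp add: WW)
    also have "\<dots> = W * A' * mat_adjoint W"
      using W(1) Wc A by (simp add: A'_def as)
    also have "\<dots> = (W * ?V) * real_diag ?n s * mat_adjoint (W * ?V)"
      unfolding UU A'eq using W(1) Wc Vc(1) adjoint_carrier[OF Vc(1)] real_diag_carrier[of ?n s]
      by (simp add: as del: One_nat_def)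
    finally show ?case using 1 W Vc by (intro exI[of _ "W * ?V"] exI[of _ s]) auto
  qed
  then show ?thesis using that by blast
qed

lemma qform_real_diag:
  assumes "w \<in> carrier_vec n"
  shows "qform (real_diag n r) w = (\<Sum>i<n. r i * (cmod (w $ i))\<^sup>2)"
proof -
  have "(real_diag n r *\<^sub>v w) $ i = complex_of_real (r i) * w $ i" if "i < n" for i
  proof -
    have "(real_diag n r *\<^sub>v w) $ i = (\<Sum>k<n. real_diag n r $$ (i, k) * w $ k)"
      using that assms carrier_matD[OF real_diag_carrier[of n r]]
      by (simp add: scalar_prod_def lessThan_atLeast0)
    also have "\<dots> = (\<Sum>k<n. if k = i then complex_of_real (r i) * w $ i else 0)"
      using that by (intro sum.cong) (auto simp: real_diag_index)
    finally show ?thesis using that by simp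
  qed
  then have "(real_diag n r *\<^sub>v w) \<bullet>c w =
      (\<Sum>i<n. complex_of_real (r i) * (w $ i * cnj (w $ i)))"
    using assms by (auto simp: scalar_prod_def lessThan_atLeast0 mult.assoc intro!: sum.cong)
  also have "\<dots> = complex_of_real (\<Sum>i<n. r i * (cmod (w $ i))\<^sup>2)"
    by (simp add: complex_norm_square[symmetric])
  finally show ?thesis by (simp add: qform_def)
qed

lemma real_diag_herm: "real_diag n r \<in> herm n"
  by (auto simp: herm_def real_diag_def intro!: eq_matI)

lemma real_diag_psd: "(\<And>i. i < n \<Longrightarrow> 0 \<le> r i) \<Longrightarrow> real_diag n r \<in> psd n"
  by (auto simp: psd_iff_qform real_diag_herm qform_real_diag intro!: sum_nonneg)

text \<open>The form is diagonal in the eigenbasis. The norm identity is the same computation with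
  the identity as the diagonal matrix, that is, unitary invariance of the norm.\<close>

lemma qform_spectral:
  assumes U: "U \<in> carrier_mat n n" "mat_adjoint U * U = 1\<^sub>m n"
    and A: "A = U * real_diag n r * mat_adjoint U" and v: "v \<in> carrier_vec n"
  defines "w \<equiv> mat_adjoint U *\<^sub>v v"
  shows "qform A v = (\<Sum>i<n. r i * (cmod (w $ i))\<^sup>2)"
    and "Re (v \<bullet>c v) = (\<Sum>i<n. (cmod (w $ i))\<^sup>2)"
proof -
  have w: "w \<in> carrier_vec n" unfolding w_def by (rule mult_mat_vec_carrier[OF adjoint_carrier[OF U(1)] v])
  have *: "qform (U * D * mat_adjoint U) v = qform D w" if "D \<in> carrier_mat n n" for D
    using qform_congruence[of D n "mat_adjoint U" n v] that U v by (simp add: w_def)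
  show "qform A v = (\<Sum>i<n. r i * (cmod (w $ i))\<^sup>2)"
    using *[of "real_diag n r"] qform_real_diag[OF w] A by simp
  have "U * 1\<^sub>m n * mat_adjoint U = 1\<^sub>m n"
    using U unitary_right_inverse[OF U] by simp
  then show "Re (v \<bullet>c v) = (\<Sum>i<n. (cmod (w $ i))\<^sup>2)"
    using *[of "1\<^sub>m n"] qform_one[OF v] qform_one[OF w] cscalar_self_sum[OF w] by simp
qed

text \<open>The columns of \<open>U\<close> are eigenvectors: read
  \<open>A * U = U * real_diag n r\<close> column by column. A column is nonzero because its
  diagonal entry in \<open>mat_adjoint U * U\<close> is 1.\<close>

lemma spectral_eigenvalue:
  assumes U: "U \<in> carrier_mat n n" "mat_adjoint U * U = 1\<^sub>m n"
    and A: "A = U * real_diag n r * mat_adjoint U" and i: "i < n"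
  shows "eigenvalue A (complex_of_real (r i))"
proof -
  have Ac: "A \<in> carrier_mat n n"
    using U(1) unfolding A by (intro mult_carrier_mat[of _ n n]) auto
  have "A * U = U * real_diag n r * (mat_adjoint U * U)"
    using U(1) unfolding A
    by (intro assoc_mult_mat[of _ n n _ n _ n]) (auto intro!: mult_carrier_mat[of _ n n _ n])
  also have "\<dots> = U * real_diag n r"
    unfolding U(2) by (rule right_mult_one_mat[OF mult_carrier_mat[OF U(1) real_diag_carrier]])
  finally have AU: "A * U = U * real_diag n r" .
  have "A *\<^sub>v col U i = col (A * U) i"
    using U Ac i by (intro col_mult2[symmetric, of _ n n _ n]) auto
  also have "\<dots> = complex_of_real (r i) \<cdot>\<^sub>v col U i"
  proof (rule eq_vecI)
    fix k assume "k < dim_vec (complex_of_real (r i) \<cdot>\<^sub>v col U i)"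
    then have k: "k < n" using U by simp
    have 1: "(U * real_diag n r) $$ (k, i) =
        (\<Sum>j<n. if j = i then U $$ (k, i) * complex_of_real (r i) else 0)"
      unfolding mult_index[OF U(1) real_diag_carrier k i]
      using i by (intro sum.cong) (auto simp: real_diag_index)
    have "col (A * U) i $ k = (U * real_diag n r) $$ (k, i)"
      using carrier_matD[OF mult_carrier_mat[OF U(1) real_diag_carrier[of n r]]] k i
      unfolding AU by (intro index_col) auto
    then show "col (A * U) i $ k = (complex_of_real (r i) \<cdot>\<^sub>v col U i) $ k"
      unfolding 1 using U k i by (simp add: mult.commute)
  qed (use U AU in auto)
  finally have ev: "A *\<^sub>v col U i = complex_of_real (r i) \<cdot>\<^sub>v col U i" .
  have "col U i \<noteq> 0\<^sub>v n"
  proof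
    assume 0: "col U i = 0\<^sub>v n"
    have "(mat_adjoint U * U) $$ (i, i) = row (mat_adjoint U) i \<bullet> col U i"
      using U(1) i by simp
    also have "\<dots> = 0" unfolding 0 using U i by simp
    finally show False using i by (simp add: U(2))
  qed
  moreover have "col U i \<in> carrier_vec n" using U(1) by auto
  ultimately show ?thesis
    using ev Ac unfolding eigenvalue_def eigenvector_def by auto
qed

section \<open>Extreme eigenvalues as bounds on the quadratic form\<close>

lemma finite_real_eigenvalues:
  assumes "A \<in> carrier_mat N N"
  shows "finite {x. eigenvalue A (complex_of_real x)}"
proof -
  have "complex_of_real ` {x. eigenvalue A (complex_of_real x)} \<subseteq> spectrum A"
    by (auto simp: spectrum_def)
  then show ?thesis
    using card_finite_spectrum(1)[OF assms] finite_subset finite_imageD inj_of_real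
    by (metis inj_on_subset subset_UNIV)
qed

text \<open>\<open>Min\<close> and \<open>Max\<close> in \<open>min_eig\<close> and
  \<open>max_eig\<close> are meaningful only on a nonempty set; the spectral theorem supplies a
  member as soon as the dimension is positive.\<close>

lemma real_eigenvalues_nonempty:
  assumes "A \<in> herm N" "0 < N"
  shows "{x. eigenvalue A (complex_of_real x)} \<noteq> {}"
proof -
  obtain U r where "U \<in> carrier_mat N N" "mat_adjoint U * U = 1\<^sub>m N"
    "A = U * real_diag N r * mat_adjoint U"
    by (rule herm_spectral[OF assms(1)])
  then have "eigenvalue A (complex_of_real (r 0))"
    using assms(2) by (rule spectral_eigenvalue)
  then show ?thesis by blast
qed

lemma min_eig_eigenvalue:
  assumes "A \<in> herm N" "0 < N"
  shows "eigenvalue A (complex_of_real (min_eig A))"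
  unfolding min_eig_def
  using Min_in[OF finite_real_eigenvalues[OF herm_carrier[OF assms(1)]]
      real_eigenvalues_nonempty[OF assms]]
  by (rule CollectD)

lemma qform_eigenvector:
  assumes "A \<in> carrier_mat N N" "v \<in> carrier_vec N" "A *\<^sub>v v = complex_of_real x \<cdot>\<^sub>v v"
  shows "qform A v = x * Re (v \<bullet>c v)"
  using assms by (simp add: qform_def)

lemma min_eig_eigenvector:
  assumes "A \<in> herm N" "0 < N"
  obtains v where "v \<in> carrier_vec N" "v \<noteq> 0\<^sub>v N" "qform A v = min_eig A * Re (v \<bullet>c v)"
proof -
  from min_eig_eigenvalue[OF assms] obtain v
    where "v \<in> carrier_vec N" "v \<noteq> 0\<^sub>v N" "A *\<^sub>v v = complex_of_real (min_eig A) \<cdot>\<^sub>v v"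
    using herm_carrier[OF assms(1)] unfolding eigenvalue_def eigenvector_def by auto
  then show ?thesis using that qform_eigenvector[OF herm_carrier[OF assms(1)]] by blast
qed

text \<open>In the eigenbasis the form is the sum of the eigenvalues with weights
  \<open>(cmod (w $ i))\<^sup>2\<close>, and these weights add up to the squared norm of
  \<open>v\<close>.\<close>

lemma min_eig_le_qform:
  assumes "A \<in> herm N" "v \<in> carrier_vec N"
  shows "min_eig A * Re (v \<bullet>c v) \<le> qform A v"
proof -
  obtain U r where U: "U \<in> carrier_mat N N" "mat_adjoint U * U = 1\<^sub>m N"
    and A: "A = U * real_diag N r * mat_adjoint U"
    using herm_spectral[OF assms(1)] by blast
  have "min_eig A \<le> r i" if "i < N" for i
    unfolding min_eig_def
    using finite_real_eigenvalues[OF herm_carrier[OF assms(1)]] spectral_eigenvalue[OF U A that]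
    by simp
  then show ?thesis
    unfolding qform_spectral[OF U A assms(2)] sum_distrib_left
    by (intro sum_mono mult_right_mono) auto
qed

lemma qform_le_max_eig:
  assumes "A \<in> herm N" "v \<in> carrier_vec N"
  shows "qform A v \<le> max_eig A * Re (v \<bullet>c v)"
proof -
  obtain U r where U: "U \<in> carrier_mat N N" "mat_adjoint U * U = 1\<^sub>m N"
    and A: "A = U * real_diag N r * mat_adjoint U"
    using herm_spectral[OF assms(1)] by blast
  have "r i \<le> max_eig A" if "i < N" for i
    unfolding max_eig_def
    using finite_real_eigenvalues[OF herm_carrier[OF assms(1)]] spectral_eigenvalue[OF U A that]
    by simp
  then show ?thesis
    unfolding qform_spectral[OF U A assms(2)] sum_distrib_left
    by (intro sum_mono mult_right_mono) auto
qed

section \<open>Square roots and inverses\<close>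

text \<open>Take roots of the eigenvalues in an eigenbasis. They are nonnegative because the form at
  an eigenvector is the eigenvalue times a positive number.\<close>

lemma psd_sqrt_exists:
  assumes "A \<in> psd N"
  obtains S where "S \<in> psd N" "S * S = A"
proof -
  obtain U r where U: "U \<in> carrier_mat N N" "mat_adjoint U * U = 1\<^sub>m N"
    and A: "A = U * real_diag N r * mat_adjoint U"
    using herm_spectral[OF psd_herm[OF assms]] by blast
  have r: "0 \<le> r i" if i: "i < N" for i
  proof -
    from spectral_eigenvalue[OF U A i] obtain v
      where v: "v \<in> carrier_vec N" "v \<noteq> 0\<^sub>v N" "A *\<^sub>v v = complex_of_real (r i) \<cdot>\<^sub>v v"
      using psd_carrier[OF assms] unfolding eigenvalue_def eigenvector_def by auto
    have "0 \<le> r i * Re (v \<bullet>c v)"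
      using qform_eigenvector[OF psd_carrier[OF assms] v(1,3)] assms v by (auto simp: psd_iff_qform)
    then show ?thesis
      using cscalar_self_pos[OF v(1,2)] by (simp add: zero_le_mult_iff)
  qed
  let ?D = "real_diag N (\<lambda>i. sqrt (r i))"
  define S where "S = U * ?D * mat_adjoint U"
  have "?D \<in> psd N" using r by (intro real_diag_psd) auto
  then have "S \<in> psd N"
    using psd_congruence[of ?D N "mat_adjoint U" N] U by (simp add: S_def)
  moreover have "S * S = A"
  proof -
    have DD: "?D * ?D = real_diag N r"
    proof (rule eq_matI)
      fix i j assume "i < dim_row (real_diag N r)" "j < dim_col (real_diag N r)"
      then have ij: "i < N" "j < N" by (auto simp: real_diag_def)
      have "(?D * ?D) $$ (i, j) =
          (\<Sum>k<N. if k = i then (if i = j then complex_of_real (sqrt (r i) * sqrt (r i)) else 0) else 0)"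
        unfolding mult_index[OF real_diag_carrier real_diag_carrier ij]
        using ij by (intro sum.cong) (auto simp: real_diag_index simp del: real_sqrt_mult_self)
      then show "(?D * ?D) $$ (i, j) = real_diag N r $$ (i, j)"
        using ij r by (simp add: real_diag_def del: of_real_mult)
    qed (auto simp: real_diag_def)
    have Uc: "mat_adjoint U \<in> carrier_mat N N" using U by simp
    note as = assoc_mult_mat[of _ N N _ N _ N] mult_carrier_mat[of _ N N _ N]
    have "S * S = U * (?D * (mat_adjoint U * (U * (?D * mat_adjoint U))))"
      unfolding S_def using U(1) Uc by (simp add: as)
    also have "mat_adjoint U * (U * (?D * mat_adjoint U)) = ?D * mat_adjoint U"
      using U Uc by (intro mult_cancel_left_inverse[of _ N N _ _ N]) (auto intro!: as(2))
    also have "U * (?D * (?D * mat_adjoint U)) = U * (?D * ?D) * mat_adjoint U"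
      using U(1) Uc by (simp add: as)
    finally show ?thesis by (simp add: DD A)
  qed
  ultimately show ?thesis using that by blast
qed

lemma psd_gram_factor:
  assumes "A \<in> psd N"
  obtains C where "C \<in> carrier_mat N N" "A = mat_adjoint C * C"
proof -
  obtain S where "S \<in> psd N" "S * S = A" by (rule psd_sqrt_exists[OF assms])
  then show ?thesis using that[of S] by (metis herm_adjoint psd_carrier psd_herm)
qed

lemma psd_sqrt_unique:
  assumes S: "S \<in> psd N" and T: "T \<in> psd N" and eq: "S * S = T * T"
  shows "S = T"
proof -
  have c: "S \<in> carrier_mat N N" "T \<in> carrier_mat N N" using S T by (auto simp: psd_carrier)
  \<comment> \<open>\<open>S X + X T = 0\<close>, so an eigenvector \<open>v\<close> of \<open>X\<close> for \<open>r \<noteq> 0\<close> has \<open>\<langle>S v, v\<rangle> + \<langle>T v, v\<rangle> = 0\<close>; both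
    terms then vanish, and so does \<open>r \<langle>v, v\<rangle> = \<langle>X v, v\<rangle>\<close>.\<close>
  define X where "X = S - T"
  have X: "X \<in> herm N" unfolding X_def using S T by (intro herm_minus psd_herm)
  have Xc: "X \<in> carrier_mat N N" by (rule herm_carrier[OF X])
  obtain U r where U: "U \<in> carrier_mat N N" "mat_adjoint U * U = 1\<^sub>m N"
    and XU: "X = U * real_diag N r * mat_adjoint U"
    using herm_spectral[OF X] by blast
  have "r i = 0" if i: "i < N" for i
  proof (rule ccontr)
    assume r: "r i \<noteq> 0"
    from spectral_eigenvalue[OF U XU i] obtain v
      where v: "v \<in> carrier_vec N" "v \<noteq> 0\<^sub>v N" "X *\<^sub>v v = complex_of_real (r i) \<cdot>\<^sub>v v"
      using Xc unfolding eigenvalue_def eigenvector_def by auto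
    have "S * X + X * T = (S * S - S * T) + (S * T - T * T)"
      unfolding X_def using c
      by (simp add: mult_minus_distrib_mat[of _ N N] minus_mult_distrib_mat[of _ N N])
    also have "\<dots> = 0\<^sub>m N N"
      unfolding eq using c by (intro eq_matI) auto
    finally have sum0: "S * X + X * T = 0\<^sub>m N N" .
    have "(S * X) *\<^sub>v v = complex_of_real (r i) \<cdot>\<^sub>v (S *\<^sub>v v)"
      using c Xc v by (simp add: assoc_mult_mat_vec[of _ N N _ N] mult_mat_vec[of _ N N])
    then have 1: "qform (S * X) v = r i * qform S v"
      using c v by (simp add: qform_def)
    have "((X * T) *\<^sub>v v) \<bullet>c v = (T *\<^sub>v v) \<bullet>c (X *\<^sub>v v)"
      using c Xc v cscalar_prod_adjoint[of X N N "T *\<^sub>v v" v]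
      by (simp add: herm_adjoint[OF X] assoc_mult_mat_vec[of _ N N _ N])
    also have "\<dots> = complex_of_real (r i) * ((T *\<^sub>v v) \<bullet>c v)"
      using c v by (simp add: v(3) conjugate_smult_vec)
    finally have 2: "qform (X * T) v = r i * qform T v"
      by (simp add: qform_def)
    have "qform (S * X + X * T) v = qform (S * X) v + qform (X * T) v"
      using c Xc v by (intro qform_add[of _ N]) auto
    then have "r i * (qform S v + qform T v) = 0"
      using qform_zero[OF v(1)] 1 2 unfolding sum0 by (simp add: algebra_simps)
    moreover have "0 \<le> qform S v" "0 \<le> qform T v"
      using S T v by (auto simp: psd_iff_qform)
    ultimately have "qform S v = 0" "qform T v = 0"
      using r by auto
    then have "qform X v = 0"
      unfolding X_def using c v by (simp add: qform_minus[of _ N])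
    then show False
      using qform_eigenvector[OF Xc v(1,3)] cscalar_self_pos[OF v(1,2)] r by simp
  qed
  then have "real_diag N r = 0\<^sub>m N N"
    by (intro eq_matI) (auto simp: real_diag_def)
  then have "X = 0\<^sub>m N N" using XU U by simp
  then have "(S - T) $$ (i, j) = 0" if "i < N" "j < N" for i j
    using that by (simp add: X_def)
  then show ?thesis using c by (intro eq_matI) auto
qed

text \<open>\<open>psd_sqrt\<close> is a definite description, so it takes existence and uniqueness
  together to compute with it.\<close>

lemma psd_sqrt_psd:
  assumes "A \<in> psd N"
  shows "psd_sqrt A \<in> psd N" "psd_sqrt A * psd_sqrt A = A"
proof -
  obtain S where S: "S \<in> psd N" "S * S = A" by (rule psd_sqrt_exists[OF assms])
  have "psd_sqrt A = S"
    unfolding psd_sqrt_def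
  proof (rule the_equality)
    show "S \<in> psd (dim_row A) \<and> S * S = A" using S psd_carrier[OF assms] by simp
    show "T = S" if "T \<in> psd (dim_row A) \<and> T * T = A" for T
      using that S psd_carrier[OF assms] psd_sqrt_unique[of T N S] by (metis carrier_matD(1))
  qed
  then show "psd_sqrt A \<in> psd N" "psd_sqrt A * psd_sqrt A = A"
    using S by simp_all
qed

text \<open>\<open>minv\<close> applies \<open>the\<close> to an option. Injectivity makes the
  determinant nonzero, hence \<open>A\<close> a unit of the matrix ring, hence the option a
  \<open>Some\<close>.\<close>

lemma minv_inverse:
  assumes A: "A \<in> carrier_mat N N"
    and inj: "\<And>v. v \<in> carrier_vec N \<Longrightarrow> A *\<^sub>v v = 0\<^sub>v N \<Longrightarrow> v = 0\<^sub>v N"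
  shows "minv A \<in> carrier_mat N N" "A * minv A = 1\<^sub>m N" "minv A * A = 1\<^sub>m N"
proof -
  have "det A \<noteq> 0" using det_0_iff_vec_prod_zero[OF A] inj by blast
  then have "A \<in> Units (ring_mat TYPE(complex) N undefined)"
    by (rule det_non_zero_imp_unit[OF A])
  then obtain B where "mat_inverse A = Some B"
    using mat_inverse(1)[OF A, of undefined] by (cases "mat_inverse A") auto
  then show "minv A \<in> carrier_mat N N" "A * minv A = 1\<^sub>m N" "minv A * A = 1\<^sub>m N"
    using mat_inverse(2)[OF A] by (auto simp: minv_def)
qed

lemma inverse_herm:
  assumes A: "A \<in> herm N" and B: "B \<in> carrier_mat N N" "A * B = 1\<^sub>m N" "B * A = 1\<^sub>m N"
  shows "B \<in> herm N"
proof -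
  have Ac: "A \<in> carrier_mat N N" by (rule herm_carrier[OF A])
  have "mat_adjoint B = mat_adjoint B * (A * B)" using B by simp
  also have "\<dots> = mat_adjoint (A * B) * B"
    using Ac B(1) by (subst adjoint_mult[of _ N N _ N])
      (auto simp: herm_adjoint[OF A] assoc_mult_mat[of _ N N _ N _ N])
  also have "\<dots> = B" using B by simp
  finally show ?thesis using B by (simp add: herm_def)
qed

section \<open>Traces\<close>

lemma tr_mult:
  assumes "A \<in> carrier_mat n m" "B \<in> carrier_mat m n"
  shows "tr (A * B) = (\<Sum>i<n. \<Sum>k<m. A $$ (i, k) * B $$ (k, i))"
proof -
  have "tr (A * B) = (\<Sum>i<n. (A * B) $$ (i, i))"
    using assms by (simp add: tr_def)
  also have "\<dots> = (\<Sum>i<n. \<Sum>k<m. A $$ (i, k) * B $$ (k, i))"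
    by (rule sum.cong[OF refl], rule mult_index[OF assms]) auto
  finally show ?thesis .
qed

lemma tr_mult_comm:
  assumes "A \<in> carrier_mat n m" "B \<in> carrier_mat m n"
  shows "tr (A * B) = tr (B * A)"
  unfolding tr_mult[OF assms] tr_mult[OF assms(2,1)]
  by (rule trans[OF sum.swap]) (intro sum.cong refl mult.commute)

lemma tr_add:
  assumes "A \<in> carrier_mat n n" "B \<in> carrier_mat n n"
  shows "tr (A + B) = tr A + tr B"
proof -
  have "tr (A + B) = (\<Sum>i<n. A $$ (i, i) + B $$ (i, i))"
    unfolding tr_def by (rule sum.cong) (use assms in auto)
  then show ?thesis using assms unfolding sum.distrib tr_def by auto
qed

lemma tr_minus:
  assumes "A \<in> carrier_mat n n" "B \<in> carrier_mat n n"
  shows "tr (A - B) = tr A - tr B"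
proof -
  have "tr (A - B) = (\<Sum>i<n. A $$ (i, i) - B $$ (i, i))"
    unfolding tr_def by (rule sum.cong) (use assms in auto)
  then show ?thesis using assms unfolding sum_subtractf tr_def by auto
qed

lemma tr_smult: "A \<in> carrier_mat n n \<Longrightarrow> tr (c \<cdot>\<^sub>m A) = c * tr A"
  by (simp add: tr_def sum_distrib_left)

lemma herm_index:
  assumes "A \<in> herm N" "i < N" "j < N" shows "cnj (A $$ (i, j)) = A $$ (j, i)"
proof -
  have "mat_adjoint A $$ (j, i) = cnj (A $$ (i, j))"
    using herm_carrier[OF assms(1)] assms(2,3) by simp
  then show ?thesis by (simp only: herm_adjoint[OF assms(1)])
qed

lemma tr_mult_herm_real:
  assumes "A \<in> herm N" "B \<in> herm N"
  shows "Im (tr (A * B)) = 0"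
proof -
  have c: "A \<in> carrier_mat N N" "B \<in> carrier_mat N N" using assms by (auto simp: herm_carrier)
  have "cnj (tr (A * B)) = (\<Sum>i<N. \<Sum>k<N. A $$ (k, i) * B $$ (i, k))"
    unfolding tr_mult[OF c] using herm_index[OF assms(1)] herm_index[OF assms(2)] by simp
  also have "\<dots> = tr (A * B)" unfolding tr_mult[OF c] by (rule sum.swap)
  finally show ?thesis by (metis Reals_cnj_iff complex_is_Real_iff)
qed

lemma tr_herm_real: "A \<in> herm N \<Longrightarrow> Im (tr A) = 0"
  using tr_mult_herm_real[of A N "1\<^sub>m N"] right_mult_one_mat[of A N N]
  by (simp add: herm_carrier)

lemma tr_congruence:
  assumes "A \<in> carrier_mat N N" "C \<in> carrier_mat N M"
  shows "Re (tr (mat_adjoint C * A * C)) = (\<Sum>j<M. qform A (col C j))"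
proof -
  have "(mat_adjoint C * A * C) $$ (j, j) = (A *\<^sub>v col C j) \<bullet>c col C j" if "j < M" for j
  proof -
    have "(mat_adjoint C * A * C) $$ (j, j) = (mat_adjoint C * (A * C)) $$ (j, j)"
      using assms by (simp add: assoc_mult_mat[of _ M N _ N _ M])
    also have "\<dots> = (\<Sum>k<N. cnj (C $$ (k, j)) * (A * C) $$ (k, j))"
      using assms that by (subst mult_index[of _ M N _ M]) auto
    also have "\<dots> = (A *\<^sub>v col C j) \<bullet>c col C j"
      using assms that by (auto simp: scalar_prod_def lessThan_atLeast0 mult.commute intro!: sum.cong)
    finally show ?thesis .
  qed
  then show ?thesis using assms by (simp add: tr_def qform_def)
qed

text \<open>With \<open>B = mat_adjoint C * C\<close>, cyclicity turns the trace into that of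
  \<open>C * A * mat_adjoint C\<close>, a sum of values of the quadratic form of
  \<open>A\<close>.\<close>

lemma tr_mult_psd_nonneg:
  assumes A: "A \<in> psd N" and B: "B \<in> psd N"
  shows "0 \<le> Re (tr (A * B))"
proof -
  obtain C where C: "C \<in> carrier_mat N N" and BC: "B = mat_adjoint C * C"
    by (rule psd_gram_factor[OF B])
  have Ac: "A \<in> carrier_mat N N" by (rule psd_carrier[OF A])
  have "tr (A * B) = tr ((A * mat_adjoint C) * C)"
    unfolding BC using Ac C by (simp add: assoc_mult_mat[of _ N N _ N _ N])
  also have "\<dots> = tr (C * (A * mat_adjoint C))"
    using Ac C by (intro tr_mult_comm[of _ N N]) auto
  also have "\<dots> = tr (mat_adjoint (mat_adjoint C) * A * mat_adjoint C)"
    using Ac C by (simp add: assoc_mult_mat[of _ N N _ N _ N])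
  finally show ?thesis
    using tr_congruence[OF Ac adjoint_carrier[OF C]] A C
    by (auto simp: psd_iff_qform intro!: sum_nonneg)
qed

lemma tr_psd_nonneg: "A \<in> psd N \<Longrightarrow> 0 \<le> Re (tr A)"
  using tr_mult_psd_nonneg[OF _ psd_one, of A N] right_mult_one_mat[of A N N]
  by (simp add: psd_carrier)

text \<open>For \<open>A = mat_adjoint C * C\<close> the trace is the sum of the squared column
  norms of \<open>C\<close>. The strict positivity results on traces below rest on this.\<close>

lemma psd_tr_zero:
  assumes A: "A \<in> psd N" and 0: "Re (tr A) = 0"
  shows "A = 0\<^sub>m N N"
proof -
  obtain C where C: "C \<in> carrier_mat N N" and AC: "A = mat_adjoint C * C"
    by (rule psd_gram_factor[OF A])
  have "Re (tr A) = (\<Sum>j<N. Re (col C j \<bullet>c col C j))"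
    using tr_congruence[OF one_carrier_mat C] C
    by (simp add: AC qform_one[of _ N] right_mult_one_mat[of "mat_adjoint C" N N])
  then have "\<forall>j\<in>{..<N}. Re (col C j \<bullet>c col C j) = 0"
    using 0 cscalar_self_nonneg
      sum_nonneg_eq_0_iff[of "{..<N}" "\<lambda>j. Re (col C j \<bullet>c col C j)"] by auto
  then have "col C j = 0\<^sub>v N" if "j < N" for j
    using cscalar_self_pos[of "col C j" N] C that by fastforce
  then have "C $$ (i, j) = 0" if "i < N" "j < N" for i j
    using C that by (metis carrier_matD index_col index_zero_vec(1))
  then have "C = 0\<^sub>m N N" using C by (intro eq_matI) auto
  then show ?thesis by (simp add: AC)
qed

text \<open>The squared norm of \<open>v\<close> times the projection onto its span.\<close>

definition outer :: "complex vec \<Rightarrow> complex mat" where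
  "outer v = mat (dim_vec v) (dim_vec v) (\<lambda>(i, j). v $ i * cnj (v $ j))"

lemma outer_psd:
  assumes "v \<in> carrier_vec N" shows "outer v \<in> psd N"
proof -
  let ?C = "mat 1 N (\<lambda>(_, j). cnj (v $ j))"
  have "outer v = mat_adjoint ?C * ?C"
    using assms by (intro eq_matI) (auto simp: outer_def scalar_prod_def)
  then show ?thesis using psd_gram[of ?C 1 N] by simp
qed

lemma tr_mult_outer:
  assumes "A \<in> carrier_mat N N" "v \<in> carrier_vec N"
  shows "Re (tr (A * outer v)) = qform A v"
proof -
  have "tr (A * outer v) = (\<Sum>i<N. \<Sum>k<N. A $$ (i, k) * outer v $$ (k, i))"
    by (rule tr_mult[OF assms(1) psd_carrier[OF outer_psd[OF assms(2)]]])
  also have "\<dots> = (\<Sum>i<N. \<Sum>k<N. A $$ (i, k) * v $ k * cnj (v $ i))"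
    using assms(2) by (intro sum.cong) (auto simp: outer_def)
  also have "\<dots> = (A *\<^sub>v v) \<bullet>c v"
    using assms
    by (auto simp: scalar_prod_def lessThan_atLeast0 sum_distrib_right intro!: sum.cong)
  finally show ?thesis by (simp add: qform_def)
qed

section \<open>Kronecker products\<close>

text \<open>An index of a Kronecker product encodes the pair of \<open>p\<close> and
  \<open>q\<close> as \<open>p * d + q\<close>. Decoding the summation index splits a product of
  Kronecker products into two independent sums.\<close>

lemma sum_div_mod:
  fixes g :: "nat \<Rightarrow> nat \<Rightarrow> complex"
  shows "(\<Sum>k<b * d. g (k div d) (k mod d)) = (\<Sum>p<b. \<Sum>q<d. g p q)"
proof -
  have "(\<Sum>k<b * d. g (k div d) (k mod d)) =
      (\<Sum>p<b. \<Sum>k\<in>{p * d..<p * d + d}. g (k div d) (k mod d))"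
    by (rule sum.nat_group[symmetric])
  also have "\<dots> = (\<Sum>p<b. \<Sum>q<d. g p q)"
  proof (rule sum.cong[OF refl])
    fix p
    have "(\<Sum>k\<in>{0 + p * d..<d + p * d}. g (k div d) (k mod d)) =
        (\<Sum>q\<in>{0..<d}. g ((q + p * d) div d) ((q + p * d) mod d))"
      by (rule sum.shift_bounds_nat_ivl)
    also have "\<dots> = (\<Sum>q\<in>{0..<d}. g p q)"
      by (rule sum.cong) auto
    finally show "(\<Sum>k\<in>{p * d..<p * d + d}. g (k div d) (k mod d)) = (\<Sum>q<d. g p q)"
      by (simp add: add.commute lessThan_atLeast0)
  qed
  finally show ?thesis .
qed

lemma div_mod_less:
  fixes i :: nat assumes "i < a * c" shows "i div c < a" "i mod c < c"
proof -
  have "0 < c" using assms by (cases c) auto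
  then show "i div c < a" "i mod c < c" using assms by (auto simp: less_mult_imp_div_less)
qed

lemma kron_dim [simp]:
  "dim_row (kron A B) = dim_row A * dim_row B" "dim_col (kron A B) = dim_col A * dim_col B"
  by (auto simp: kron_def)

lemma kron_index:
  "i < dim_row A * dim_row B \<Longrightarrow> j < dim_col A * dim_col B \<Longrightarrow>
    kron A B $$ (i, j) =
      A $$ (i div dim_row B, j div dim_col B) * B $$ (i mod dim_row B, j mod dim_col B)"
  by (simp add: kron_def)

lemma kron_mult:
  assumes "dim_col A = dim_row A'" "dim_col B = dim_row B'"
  shows "kron A B * kron A' B' = kron (A * A') (B * B')"
proof (rule eq_matI)
  fix i j assume "i < dim_row (kron (A * A') (B * B'))" "j < dim_col (kron (A * A') (B * B'))"
  then have i: "i < dim_row A * dim_row B" and j: "j < dim_col A' * dim_col B'" by auto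
  note ib = div_mod_less[OF i] and jb = div_mod_less[OF j]
  let ?b = "dim_row A'" and ?d = "dim_row B'"
  let ?i1 = "i div dim_row B" and ?i2 = "i mod dim_row B"
  let ?j1 = "j div dim_col B'" and ?j2 = "j mod dim_col B'"
  have "(kron A B * kron A' B') $$ (i, j) =
      (\<Sum>k<?b * ?d. kron A B $$ (i, k) * kron A' B' $$ (k, j))"
    using assms i j by (intro mult_index) auto
  also have "\<dots> = (\<Sum>k<?b * ?d. A $$ (?i1, k div ?d) * B $$ (?i2, k mod ?d) *
      (A' $$ (k div ?d, ?j1) * B' $$ (k mod ?d, ?j2)))"
    using assms i j by (intro sum.cong refl) (simp add: kron_index)
  also have "\<dots> = (\<Sum>p<?b. \<Sum>q<?d. A $$ (?i1, p) * B $$ (?i2, q) * (A' $$ (p, ?j1) * B' $$ (q, ?j2)))"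
    by (rule sum_div_mod)
  also have "\<dots> = (\<Sum>p<?b. A $$ (?i1, p) * A' $$ (p, ?j1)) * (\<Sum>q<?d. B $$ (?i2, q) * B' $$ (q, ?j2))"
    by (simp add: sum_product ac_simps)
  also have "(\<Sum>p<?b. A $$ (?i1, p) * A' $$ (p, ?j1)) = (A * A') $$ (?i1, ?j1)"
    using assms ib jb by (intro mult_index[symmetric]) auto
  also have "(\<Sum>q<?d. B $$ (?i2, q) * B' $$ (q, ?j2)) = (B * B') $$ (?i2, ?j2)"
    using assms ib jb by (intro mult_index[symmetric]) auto
  also have "(A * A') $$ (?i1, ?j1) * (B * B') $$ (?i2, ?j2) = kron (A * A') (B * B') $$ (i, j)"
    using i j by (simp add: kron_index)
  finally show "(kron A B * kron A' B') $$ (i, j) = kron (A * A') (B * B') $$ (i, j)" .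
qed auto

lemma kron_adjoint: "mat_adjoint (kron A B) = kron (mat_adjoint A) (mat_adjoint B)"
proof (rule eq_matI)
  fix i j assume "i < dim_row (kron (mat_adjoint A) (mat_adjoint B))"
    "j < dim_col (kron (mat_adjoint A) (mat_adjoint B))"
  then have i: "i < dim_col A * dim_col B" and j: "j < dim_row A * dim_row B" by auto
  show "mat_adjoint (kron A B) $$ (i, j) = kron (mat_adjoint A) (mat_adjoint B) $$ (i, j)"
    using i j div_mod_less[OF i] div_mod_less[OF j] by (simp add: kron_index)
qed auto

lemma kron_one: "kron (1\<^sub>m a) (1\<^sub>m c) = 1\<^sub>m (a * c)"
proof (rule eq_matI)
  fix i j assume "i < dim_row (1\<^sub>m (a * c))" "j < dim_col (1\<^sub>m (a * c))"
  then have i: "i < a * c" and j: "j < a * c" by auto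
  have "i = j \<longleftrightarrow> i div c = j div c \<and> i mod c = j mod c"
    by (metis div_mult_mod_eq)
  then show "kron (1\<^sub>m a) (1\<^sub>m c) $$ (i, j) = 1\<^sub>m (a * c) $$ (i, j)"
    using i j div_mod_less[OF i] div_mod_less[OF j] by (auto simp: kron_index)
qed auto

lemma kron_smult: "kron (x \<cdot>\<^sub>m A) (y \<cdot>\<^sub>m B) = (x * y) \<cdot>\<^sub>m kron A B"
proof (rule eq_matI)
  fix i j assume "i < dim_row ((x * y) \<cdot>\<^sub>m kron A B)" "j < dim_col ((x * y) \<cdot>\<^sub>m kron A B)"
  then have i: "i < dim_row A * dim_row B" and j: "j < dim_col A * dim_col B" by auto
  show "kron (x \<cdot>\<^sub>m A) (y \<cdot>\<^sub>m B) $$ (i, j) = ((x * y) \<cdot>\<^sub>m kron A B) $$ (i, j)"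
    using i j div_mod_less[OF i] div_mod_less[OF j] by (simp add: kron_index)
qed auto

text \<open>The mixed-product rule combines Gram factors of \<open>A\<close> and \<open>B\<close>
  into a Gram factor of the Kronecker product.\<close>

lemma kron_psd:
  assumes "A \<in> psd a" "B \<in> psd b" shows "kron A B \<in> psd (a * b)"
proof -
  obtain C where C: "C \<in> carrier_mat a a" "A = mat_adjoint C * C"
    by (rule psd_gram_factor[OF assms(1)])
  obtain D where D: "D \<in> carrier_mat b b" "B = mat_adjoint D * D"
    by (rule psd_gram_factor[OF assms(2)])
  have "kron A B = mat_adjoint (kron C D) * kron C D"
    using C D by (simp add: kron_adjoint kron_mult)
  moreover have "kron C D \<in> carrier_mat (a * b) (a * b)"
    using C(1) D(1) by (intro carrier_matI) auto
  ultimately show ?thesis using psd_gram by metis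
qed

lemma tensor_Nil [simp]: "tensor [] = 1\<^sub>m 1"
  by (simp add: tensor_def)

lemma tensor_Cons [simp]: "tensor (A # As) = kron A (tensor As)"
  by (simp add: tensor_def)

lemma tensor_dim [simp]:
  "dim_row (tensor As) = prod_list (map dim_row As)"
  "dim_col (tensor As) = prod_list (map dim_col As)"
  by (induction As) auto

lemma tensor_mult:
  assumes "\<And>k. k \<in> set ks \<Longrightarrow> dim_col (A k) = dim_row (B k)"
  shows "tensor (map A ks) * tensor (map B ks) = tensor (map (\<lambda>k. A k * B k) ks)"
  using assms
proof (induction ks)
  case (Cons k ks)
  have "map (dim_col \<circ> A) ks = map (dim_row \<circ> B) ks" using Cons.prems by auto
  then have "dim_col (tensor (map A ks)) = dim_row (tensor (map B ks))"
    by (simp only: tensor_dim map_map)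
  then show ?case using Cons.IH Cons.prems by (simp add: kron_mult del: tensor_dim)
qed auto

lemma tensor_adjoint: "mat_adjoint (tensor (map A ks)) = tensor (map (\<lambda>k. mat_adjoint (A k)) ks)"
  by (induction ks) (auto simp: kron_adjoint)

lemma tensor_one: "tensor (map 1\<^sub>m d) = 1\<^sub>m (prod_list d)"
  by (induction d) (auto simp: kron_one)

lemma tensor_smult:
  "tensor (map (\<lambda>k. c k \<cdot>\<^sub>m A k) ks) = prod_list (map c ks) \<cdot>\<^sub>m tensor (map A ks)"
  by (induction ks) (auto simp: kron_smult intro!: eq_matI)

lemma tensor_psd:
  "(\<And>k. k \<in> set ks \<Longrightarrow> A k \<in> psd (D k)) \<Longrightarrow> tensor (map A ks) \<in> psd (prod_list (map D ks))"
proof (induction ks)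
  case Nil
  then show ?case using psd_one[of 1] by simp
next
  case (Cons k ks)
  then show ?case by (simp add: kron_psd)
qed

lemma prod_list_upt_nth: "prod_list (map ((!) d) [0..<length d]) = prod_list d"
  by (simp add: map_nth)

lemma tensor_upt_psd:
  assumes "\<And>k. k < length d \<Longrightarrow> A k \<in> psd (d ! k)"
  shows "tensor (map A [0..<length d]) \<in> psd (prod_list d)"
  using tensor_psd[of "[0..<length d]" A "(!) d"] assms unfolding prod_list_upt_nth by simp

section \<open>The cone of separable operators\<close>

lemma msum_carrier [simp]: "msum N f I \<in> carrier_mat N N"
  by (simp add: msum_def)

lemma msum_empty: "msum N f {} = 0\<^sub>m N N"
  by (auto simp: msum_def intro!: eq_matI)

lemma msum_insert:
  assumes "finite I" "i \<notin> I" "f i \<in> carrier_mat N N"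
  shows "msum N f (insert i I) = f i + msum N f I"
  using assms by (auto simp: msum_def intro!: eq_matI)

lemma msum_closed:
  assumes "finite I" "\<And>i. i \<in> I \<Longrightarrow> f i \<in> K" "K \<subseteq> carrier_mat N N" "0\<^sub>m N N \<in> K"
    "\<And>A B. A \<in> K \<Longrightarrow> B \<in> K \<Longrightarrow> A + B \<in> K"
  shows "msum N f I \<in> K"
  using assms(1,2)
proof (induction I)
  case empty
  then show ?case using assms(4) by (simp add: msum_empty)
next
  case (insert i I)
  then have "f i \<in> K" "msum N f I \<in> K" by auto
  then show ?case
    using insert.hyps assms(3) by (subst msum_insert) (auto intro: assms(5))
qed

lemma states_psd: "A \<in> states N \<Longrightarrow> A \<in> psd N"
  by (simp add: states_def)

lemma product_psd:
  assumes "\<forall>k<length d. \<sigma> k \<in> states (d ! k)"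
  shows "tensor (map \<sigma> [0..<length d]) \<in> psd (prod_list d)"
  using assms by (intro tensor_upt_psd) (auto intro: states_psd)

text \<open>\<open>SEP\<close> is the convex cone generated by the products of local states. The
  rule lets later proofs work with generators instead of the data of a decomposition.\<close>

lemma SEP_induct [consumes 1, case_names zero product add]:
  assumes "E \<in> SEP d"
    and zero: "P (0\<^sub>m (prod_list d) (prod_list d))"
    and product: "\<And>c \<sigma>. 0 \<le> c \<Longrightarrow> \<forall>k<length d. \<sigma> k \<in> states (d ! k) \<Longrightarrow>
      P (complex_of_real c \<cdot>\<^sub>m tensor (map \<sigma> [0..<length d]))"
    and add: "\<And>E F. E \<in> carrier_mat (prod_list d) (prod_list d) \<Longrightarrow>
      F \<in> carrier_mat (prod_list d) (prod_list d) \<Longrightarrow> P E \<Longrightarrow> P F \<Longrightarrow> P (E + F)"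
  shows "P E"
proof -
  let ?N = "prod_list d"
  from assms(1) obtain r p \<sigma> where
    h: "\<forall>l<(r::nat). 0 \<le> p l \<and> (\<forall>k<length d. \<sigma> l k \<in> states (d ! k))" and
    E: "E = msum ?N (\<lambda>l. complex_of_real (p l) \<cdot>\<^sub>m tensor (map (\<sigma> l) [0..<length d])) {..<r}"
    unfolding SEP_def by blast
  have "E \<in> {E \<in> carrier_mat ?N ?N. P E}"
    unfolding E
  proof (rule msum_closed)
    show "complex_of_real (p l) \<cdot>\<^sub>m tensor (map (\<sigma> l) [0..<length d])
        \<in> {E \<in> carrier_mat ?N ?N. P E}" if "l \<in> {..<r}" for l
      using that h product[of "p l" "\<sigma> l"] psd_carrier[OF product_psd[of d "\<sigma> l"]] by auto
  qed (auto intro: zero add)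
  then show ?thesis by simp
qed

lemma SEP_zero: "0\<^sub>m (prod_list d) (prod_list d) \<in> SEP d"
  unfolding SEP_def by (auto simp: msum_empty intro!: exI[of _ 0])

lemma SEP_product:
  assumes "0 \<le> c" "\<forall>k<length d. \<sigma> k \<in> states (d ! k)"
  shows "complex_of_real c \<cdot>\<^sub>m tensor (map \<sigma> [0..<length d]) \<in> SEP d"
proof -
  let ?E = "complex_of_real c \<cdot>\<^sub>m tensor (map \<sigma> [0..<length d])"
  have "?E \<in> carrier_mat (prod_list d) (prod_list d)"
    using psd_carrier[OF product_psd[OF assms(2)]] by simp
  then have "?E = msum (prod_list d) (\<lambda>l::nat. ?E) {..<1}"
    by (auto simp: msum_def intro!: eq_matI)
  then show ?thesis
    unfolding SEP_def using assms
    by (intro CollectI exI[of _ 1] exI[of _ "\<lambda>_. c"] exI[of _ "\<lambda>_. \<sigma>"]) auto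
qed

lemma SEP_add:
  assumes "E \<in> SEP d" "F \<in> SEP d"
  shows "E + F \<in> SEP d"
proof -
  let ?N = "prod_list d"
  let ?t = "\<lambda>p \<sigma> l. complex_of_real (p l) \<cdot>\<^sub>m tensor (map (\<sigma> l) [0..<length d])"
  from assms(1) obtain r :: nat and p \<sigma> where
    h: "\<forall>l<r. 0 \<le> p l \<and> (\<forall>k<length d. \<sigma> l k \<in> states (d ! k))" and
    E: "E = msum ?N (?t p \<sigma>) {..<r}"
    unfolding SEP_def by blast
  from assms(2) obtain s :: nat and q \<tau> where
    h': "\<forall>l<s. 0 \<le> q l \<and> (\<forall>k<length d. \<tau> l k \<in> states (d ! k))" and
    F: "F = msum ?N (?t q \<tau>) {..<s}"
    unfolding SEP_def by blast
  \<comment> \<open>Concatenate the two decompositions: indices from \<open>r\<close> on, shifted by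
    \<open>r\<close>, belong to the second one.\<close>
  define p' where "p' l = (if l < r then p l else q (l - r))" for l
  define \<sigma>' where "\<sigma>' l = (if l < r then \<sigma> l else \<tau> (l - r))" for l
  have split: "(\<Sum>l<r + s. g l) = (\<Sum>l<r. g l) + (\<Sum>l<s. g (l + r))" for g :: "nat \<Rightarrow> complex"
    using sum.atLeastLessThan_concat[of 0 r "r + s" g] sum.shift_bounds_nat_ivl[of g 0 r s]
    by (simp add: lessThan_atLeast0 add.commute)
  have "E + F = msum ?N (?t p' \<sigma>') {..<r + s}"
    unfolding E F
    by (rule eq_matI) (auto simp: msum_def split p'_def \<sigma>'_def intro!: arg_cong2[of _ _ _ _ "(+)"] sum.cong)
  moreover have "\<forall>l<r + s. 0 \<le> p' l \<and> (\<forall>k<length d. \<sigma>' l k \<in> states (d ! k))"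
    using h h' by (auto simp: p'_def \<sigma>'_def)
  ultimately show ?thesis
    unfolding SEP_def by blast
qed

lemma SEP_psd: "E \<in> SEP d \<Longrightarrow> E \<in> psd (prod_list d)"
  by (induction rule: SEP_induct) (auto intro: psd_add psd_smult product_psd)

lemma SEP_msum:
  assumes "finite I" "\<And>i. i \<in> I \<Longrightarrow> f i \<in> SEP d"
  shows "msum (prod_list d) f I \<in> SEP d"
  using assms by (intro msum_closed) (auto intro: SEP_zero SEP_add psd_carrier SEP_psd)

lemma psd_eq_smult_state:
  assumes A: "A \<in> psd N" and N: "0 < N"
  obtains t \<sigma> where "0 \<le> t" "\<sigma> \<in> states N" "A = complex_of_real t \<cdot>\<^sub>m \<sigma>"
proof -
  have scaled: "complex_of_real (1 / Re (tr B)) \<cdot>\<^sub>m B \<in> states N"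
    if B: "B \<in> psd N" "0 < Re (tr B)" for B
  proof -
    have "tr B = complex_of_real (Re (tr B))"
      using tr_herm_real[OF psd_herm[OF B(1)]] by (simp add: complex_eq_iff)
    then show ?thesis
      using B psd_smult[OF B(1), of "1 / Re (tr B)"] psd_carrier[OF B(1)]
      by (auto simp: states_def tr_smult[of _ N] complex_eq_iff)
  qed
  show ?thesis
  proof (cases "Re (tr A) = 0")
    \<comment> \<open>Trace zero forces \<open>A\<close> to be zero, which is 0 times any state. The
      maximally mixed state serves here and exists because \<open>0 < N\<close>.\<close>
    case True
    have "Re (tr (1\<^sub>m N)) = N" by (simp add: tr_def)
    then have "complex_of_real (1 / Re (tr (1\<^sub>m N))) \<cdot>\<^sub>m 1\<^sub>m N \<in> states N"
      using N by (intro scaled) auto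
    moreover have "A = complex_of_real 0 \<cdot>\<^sub>m (complex_of_real (1 / Re (tr (1\<^sub>m N))) \<cdot>\<^sub>m 1\<^sub>m N)"
      unfolding psd_tr_zero[OF A True] by (intro eq_matI) auto
    ultimately show ?thesis using that order_refl by metis
  next
    case False
    then have "0 < Re (tr A)" using tr_psd_nonneg[OF A] by simp
    moreover have "A = complex_of_real (Re (tr A)) \<cdot>\<^sub>m (complex_of_real (1 / Re (tr A)) \<cdot>\<^sub>m A)"
      using False by (intro eq_matI) auto
    ultimately show ?thesis using that[OF _ scaled[OF A]] by (meson less_imp_le)
  qed
qed

text \<open>The traces of the factors are absorbed into the weight. Unnormalised factors are allowed
  because Kraus operators do not preserve the trace of a local state.\<close>

lemma SEP_psd_product:
  assumes d: "\<forall>k<length d. 0 < d ! k" and A: "\<And>k. k < length d \<Longrightarrow> A k \<in> psd (d ! k)"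
    and c: "0 \<le> c"
  shows "complex_of_real c \<cdot>\<^sub>m tensor (map A [0..<length d]) \<in> SEP d"
proof -
  have "\<exists>t \<sigma>. 0 \<le> t \<and> \<sigma> \<in> states (d ! k) \<and> A k = complex_of_real t \<cdot>\<^sub>m \<sigma>" if "k < length d" for k
    using psd_eq_smult_state[OF A[OF that]] d that by metis
  then obtain t \<sigma> where h: "\<And>k. k < length d \<Longrightarrow> 0 \<le> t k \<and> \<sigma> k \<in> states (d ! k) \<and>
      A k = complex_of_real (t k) \<cdot>\<^sub>m \<sigma> k"
    by metis
  have "tensor (map A [0..<length d]) = tensor (map (\<lambda>k. complex_of_real (t k) \<cdot>\<^sub>m \<sigma> k) [0..<length d])"
    using h by (intro arg_cong[of _ _ tensor] map_cong) auto
  also have "\<dots> = prod_list (map (\<lambda>k. complex_of_real (t k)) [0..<length d]) \<cdot>\<^sub>m tensor (map \<sigma> [0..<length d])"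
    by (rule tensor_smult)
  also have "prod_list (map (\<lambda>k. complex_of_real (t k)) ks) = complex_of_real (prod_list (map t ks))" for ks
    by (induction ks) auto
  finally have "complex_of_real c \<cdot>\<^sub>m tensor (map A [0..<length d]) =
      complex_of_real (c * prod_list (map t [0..<length d])) \<cdot>\<^sub>m tensor (map \<sigma> [0..<length d])"
    by (auto intro!: eq_matI)
  moreover have "0 \<le> prod_list (map t ks)" if "set ks \<subseteq> {..<length d}" for ks
    using that h by (induction ks) auto
  then have "0 \<le> c * prod_list (map t [0..<length d])" using c by (simp add: atLeast0LessThan)
  ultimately show ?thesis using SEP_product h by metis
qed

lemma SEP_one:
  assumes "\<forall>k<length d. 0 < d ! k" shows "1\<^sub>m (prod_list d) \<in> SEP d"
proof -
  have "map (\<lambda>k. 1\<^sub>m (d ! k)) [0..<length d] = (map 1\<^sub>m d :: complex mat list)"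
    by (intro nth_equalityI) auto
  moreover have "complex_of_real 1 \<cdot>\<^sub>m 1\<^sub>m N = (1\<^sub>m N :: complex mat)" for N
    by (rule eq_matI) auto
  ultimately show ?thesis
    using SEP_psd_product[OF assms, of "\<lambda>k. 1\<^sub>m (d ! k)" 1] by (simp add: tensor_one)
qed

section \<open>LOCC measurements are separable\<close>

text \<open>With the common index list \<open>[0..<length d]\<close>, products and adjoints can be
  computed factor by factor via \<open>tensor_mult\<close> and
  \<open>tensor_adjoint\<close>.\<close>

lemma on_party_eq_tensor:
  assumes "k < length d"
  shows "on_party d k K = tensor (map (\<lambda>i. if i = k then K else 1\<^sub>m (d ! i)) [0..<length d])"
  unfolding on_party_def using assms
  by (intro arg_cong[of _ _ tensor] nth_equalityI) (auto simp: nth_list_update)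

lemma prod_list_update_upt:
  assumes "k < length d"
  shows "prod_list (map (\<lambda>i. if i = k then e else d ! i) [0..<length d]) = prod_list (d[k := e])"
  using assms by (intro arg_cong[of _ _ prod_list] nth_equalityI) (auto simp: nth_list_update)

lemma on_party_carrier:
  assumes "k < length d" "K \<in> carrier_mat e (d ! k)"
  shows "on_party d k K \<in> carrier_mat (prod_list (d[k := e])) (prod_list d)"
proof (rule carrier_matI)
  have "map (dim_row \<circ> (\<lambda>i. if i = k then K else 1\<^sub>m (d ! i))) [0..<length d] =
      map (\<lambda>i. if i = k then e else d ! i) [0..<length d]"
    using assms by auto
  then show "dim_row (on_party d k K) = prod_list (d[k := e])"
    unfolding on_party_eq_tensor[OF assms(1)] tensor_dim map_map
    by (simp only: prod_list_update_upt[OF assms(1)])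
  have "map (dim_col \<circ> (\<lambda>i. if i = k then K else 1\<^sub>m (d ! i))) [0..<length d] =
      map ((!) d) [0..<length d]"
    using assms by auto
  then show "dim_col (on_party d k K) = prod_list d"
    unfolding on_party_eq_tensor[OF assms(1)] tensor_dim map_map
    by (simp only: prod_list_upt_nth)
qed

text \<open>\<open>on_party d k K\<close> is itself a product, so conjugation acts on each factor of
  a product state separately: factor \<open>k\<close> becomes
  \<open>mat_adjoint K * \<sigma> k * K\<close>, positive and of dimension \<open>d ! k\<close>, and
  the others stay. Linearity extends this to the whole cone.\<close>

lemma SEP_pullback:
  assumes d: "\<forall>i<length d. 0 < d ! i" and k: "k < length d" and K: "K \<in> carrier_mat e (d ! k)"
    and E: "E \<in> SEP (d[k := e])"
  shows "mat_adjoint (on_party d k K) * E * on_party d k K \<in> SEP d"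
proof -
  let ?T = "on_party d k K" and ?M = "prod_list (d[k := e])" and ?N = "prod_list d"
  have T: "?T \<in> carrier_mat ?M ?N" by (rule on_party_carrier[OF k K])
  have T': "mat_adjoint ?T \<in> carrier_mat ?N ?M" using T by simp
  show ?thesis
    using E
  proof (induction rule: SEP_induct)
    case zero
    have "mat_adjoint ?T * 0\<^sub>m ?M ?M * ?T = 0\<^sub>m ?N ?N" using T T' by simp
    then show ?case by (simp add: SEP_zero)
  next
    case (product c \<sigma>)
    let ?t = "\<lambda>i. if i = k then K else 1\<^sub>m (d ! i)"
    let ?S = "tensor (map \<sigma> [0..<length d])"
    have \<sigma>: "\<sigma> i \<in> psd (if i = k then e else d ! i)" if "i < length d" for i
      using product(2) that k by (auto simp: nth_list_update states_psd split: if_splits)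
    have S: "?S \<in> carrier_mat ?M ?M"
      using psd_carrier[OF product_psd[OF product(2)]] by simp
    have "mat_adjoint ?T * (complex_of_real c \<cdot>\<^sub>m ?S) * ?T =
        complex_of_real c \<cdot>\<^sub>m (mat_adjoint ?T * ?S * ?T)"
      using S T T' mult_smult_assoc_mat[OF mult_carrier_mat[OF T' S] T]
      by (simp add: mult_smult_distrib[OF T' S])
    also have "mat_adjoint ?T * ?S * ?T =
        tensor (map (\<lambda>i. mat_adjoint (?t i) * \<sigma> i * ?t i) [0..<length d])"
    proof -
      have dims: "dim_row (\<sigma> i) = (if i = k then e else d ! i)"
        "dim_col (\<sigma> i) = (if i = k then e else d ! i)" if "i < length d" for i
        using carrier_matD[OF psd_carrier[OF \<sigma>[OF that]]] by auto
      have "mat_adjoint ?T * ?S = tensor (map (\<lambda>i. mat_adjoint (?t i) * \<sigma> i) [0..<length d])"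
        unfolding on_party_eq_tensor[OF k] tensor_adjoint
        using K dims by (intro tensor_mult) auto
      moreover have "\<dots> * ?T = tensor (map (\<lambda>i. mat_adjoint (?t i) * \<sigma> i * ?t i) [0..<length d])"
        unfolding on_party_eq_tensor[OF k]
        using K dims by (intro tensor_mult) auto
      ultimately show ?thesis by simp
    qed
    also have "complex_of_real c \<cdot>\<^sub>m \<dots> \<in> SEP d"
    proof (rule SEP_psd_product[OF d _ product(1)])
      show "mat_adjoint (?t i) * \<sigma> i * ?t i \<in> psd (d ! i)" if "i < length d" for i
        using psd_congruence[OF \<sigma>[OF that], of "?t i" "d ! i"] K by (auto split: if_splits)
    qed
    finally show ?case by simp
  next
    case (add E F)
    have "mat_adjoint ?T * (E + F) * ?T = (mat_adjoint ?T * E + mat_adjoint ?T * F) * ?T"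
      using add(1,2) T' by (simp add: mult_add_distrib_mat[of _ ?N ?M])
    also have "\<dots> = mat_adjoint ?T * E * ?T + mat_adjoint ?T * F * ?T"
      using mult_carrier_mat[OF T' add(1)] mult_carrier_mat[OF T' add(2)] T
      by (rule add_mult_distrib_mat)
    finally show ?case using add SEP_add by simp
  qed
qed

theorem locc_realizes_SEP:
  assumes "locc_realizes n d M" "\<forall>k<length d. 0 < d ! k"
  shows "M j \<in> SEP d"
  using assms
proof (induction arbitrary: j)
  case (announce i d)
  then show ?case by (simp add: SEP_one SEP_zero)
next
  case (local_round k d r e s K N)
  have "mat_adjoint (on_party d k (K x y)) * N x j * on_party d k (K x y) \<in> SEP d"
    if "x < r" "y < s x" for x y
  proof (rule SEP_pullback[where e = "e x"])
    show "K x y \<in> carrier_mat (e x) (d ! k)"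
      using local_round.hyps(2) that by (auto simp: instrument_def)
    have "0 < e x" using local_round.hyps(2) that by (auto simp: instrument_def)
    \<comment> \<open>The local dimensions change along a protocol. Instruments have positive output
      dimensions, so the dimension hypothesis survives to the remaining protocol.\<close>
    then have "\<forall>i<length (d[k := e x]). 0 < d[k := e x] ! i"
      using local_round.prems by (metis length_list_update nth_list_update_eq nth_list_update_neq)
    then show "N x j \<in> SEP (d[k := e x])" using local_round.IH that by blast
  qed (use local_round.prems local_round.hyps in auto)
  then show ?case by (intro SEP_msum) auto
qed

section \<open>Block positivity\<close>

lemma Re_tr_add_mult:
  assumes "A \<in> carrier_mat N N" "B \<in> carrier_mat N N" "F \<in> carrier_mat N N"
  shows "Re (tr ((A + B) * F)) = Re (tr (A * F)) + Re (tr (B * F))"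
proof -
  have "tr ((A + B) * F) = tr (A * F + B * F)"
    by (simp only: add_mult_distrib_mat[OF assms])
  also have "\<dots> = tr (A * F) + tr (B * F)"
    by (rule tr_add[OF mult_carrier_mat[OF assms(1,3)] mult_carrier_mat[OF assms(2,3)]])
  finally show ?thesis by simp
qed

lemma Re_tr_smult_mult:
  assumes "A \<in> carrier_mat N N" "F \<in> carrier_mat N N"
  shows "Re (tr ((complex_of_real c \<cdot>\<^sub>m A) * F)) = c * Re (tr (A * F))"
proof -
  have "tr ((complex_of_real c \<cdot>\<^sub>m A) * F) = tr (complex_of_real c \<cdot>\<^sub>m (A * F))"
    by (simp only: mult_smult_assoc_mat[OF assms])
  also have "\<dots> = complex_of_real c * tr (A * F)"
    by (rule tr_smult[OF mult_carrier_mat[OF assms]])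
  finally show ?thesis by simp
qed

lemma Re_tr_minus_mult:
  assumes "A \<in> carrier_mat N N" "B \<in> carrier_mat N N" "F \<in> carrier_mat N N"
  shows "Re (tr ((A - B) * F)) = Re (tr (A * F)) - Re (tr (B * F))"
  using Re_tr_add_mult[OF assms(1) _ assms(3), of "complex_of_real (-1) \<cdot>\<^sub>m B"]
    Re_tr_smult_mult[OF assms(2,3), of "-1"] assms(2)
  unfolding minus_eq_add_smult[OF assms(1,2)] by simp

lemma block_positive_herm: "A \<in> block_positive d \<Longrightarrow> A \<in> herm (prod_list d)"
  by (simp add: block_positive_def)

lemma block_positive_SEP: "A \<in> block_positive d \<Longrightarrow> F \<in> SEP d \<Longrightarrow> 0 \<le> Re (tr (A * F))"
  by (simp add: block_positive_def)

lemma SEP_carrier: "E \<in> SEP d \<Longrightarrow> E \<in> carrier_mat (prod_list d) (prod_list d)"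
  by (rule psd_carrier[OF SEP_psd])

text \<open>The identity is separable, so block positivity can be tested on it.\<close>

lemma witness_tr_nonneg:
  assumes "V \<in> witnesses d" "\<forall>k<length d. 0 < d ! k"
  shows "0 \<le> Re (tr V)"
proof -
  have V: "V \<in> block_positive d" using assms by (simp add: witnesses_def)
  have "V * 1\<^sub>m (prod_list d) = V"
    using herm_carrier[OF block_positive_herm[OF V]] by (rule right_mult_one_mat)
  then show ?thesis using block_positive_SEP[OF V SEP_one[OF assms(2)]] by simp
qed

section \<open>The ensemble built from entanglement witnesses\<close>

text \<open>The admissible \<open>q\<close> form an intersection of closed half-lines, so their
  infimum is admissible and is the least element: for \<open>0 < b F\<close> the condition reads
  \<open>a F / b F \<le> q\<close>, and for \<open>b F = 0\<close> it reads
  \<open>a F \<le> 0\<close>, which \<open>q0\<close> guarantees. The element \<open>G\<close>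
  bounds the set from below.\<close>

lemma least_ratio_bound:
  fixes a b :: "'f \<Rightarrow> real"
  assumes b: "\<And>F. F \<in> S \<Longrightarrow> 0 \<le> b F" and G: "G \<in> S" "0 < b G"
    and q0: "\<And>F. F \<in> S \<Longrightarrow> a F \<le> q0 * b F"
  defines "q \<equiv> LEAST q. \<forall>F\<in>S. a F \<le> q * b F"
  shows "q \<le> q0" "\<And>F. F \<in> S \<Longrightarrow> a F \<le> q * b F"
proof -
  let ?Q = "{q. \<forall>F\<in>S. a F \<le> q * b F}"
  have lower: "a F / b F \<le> x" if "F \<in> S" "0 < b F" "x \<in> ?Q" for F x
    using that by (auto simp: divide_le_eq)
  have bdd: "bdd_below ?Q" using lower[OF G] by (rule bdd_belowI)
  have ne: "?Q \<noteq> {}" using q0 by blast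
  have Inf: "Inf ?Q \<in> ?Q"
  proof (intro CollectI ballI)
    fix F assume F: "F \<in> S"
    show "a F \<le> Inf ?Q * b F"
    proof (cases "b F = 0")
      case True
      then show ?thesis using q0[OF F] by simp
    next
      case False
      then have pos: "0 < b F" using b[OF F] by simp
      have "a F / b F \<le> Inf ?Q" using ne lower[OF F pos] by (rule cInf_greatest)
      then show ?thesis using pos by (simp add: divide_le_eq)
    qed
  qed
  have "q = Inf ?Q"
    unfolding q_def using Inf by (intro Least_equality) (auto intro: cInf_lower[OF _ bdd])
  then show "q \<le> q0" "\<And>F. F \<in> S \<Longrightarrow> a F \<le> q * b F"
    using Inf q0 cInf_lower[OF _ bdd] by auto
qed

lemma tr_msum:
  assumes "\<And>i. i \<in> I \<Longrightarrow> f i \<in> carrier_mat N N"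
  shows "tr (msum N f I) = (\<Sum>i\<in>I. tr (f i))"
proof -
  have "tr (msum N f I) = (\<Sum>k<N. \<Sum>i\<in>I. f i $$ (k, k))"
    by (simp add: tr_def msum_def)
  also have "\<dots> = (\<Sum>i\<in>I. \<Sum>k<N. f i $$ (k, k))" by (rule sum.swap)
  also have "\<dots> = (\<Sum>i\<in>I. tr (f i))"
    using assms by (intro sum.cong refl) (auto simp: tr_def)
  finally show ?thesis .
qed

locale witness_ensemble =
  fixes d :: "nat list" and n :: nat
    and W :: "nat \<Rightarrow> complex mat" and Wsum :: "complex mat"
    and \<epsilon> :: real and lam :: "nat \<Rightarrow> real" and Lam :: real
    and \<eta> :: "nat \<Rightarrow> real" and \<rho> :: "nat \<Rightarrow> complex mat"
  assumes dims: "\<forall>k<length d. 0 < d ! k"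
    and W: "\<forall>i\<in>{1..n}. W i \<in> witnesses d"
    and Wsum: "Wsum = msum (prod_list d) W {1..n}"
    and eps: "\<epsilon> = min_eig Wsum" "0 < \<epsilon>"
    and lam: "\<forall>i\<in>{1..n}. lam i = max_eig (W i)"
    and Lam: "Lam = (\<Sum>i\<in>{1..n}. lam i)"
    and eta: "\<forall>i\<in>{1..n}. \<eta> i =
        Re (tr (complex_of_real (lam i) \<cdot>\<^sub>m Wsum - complex_of_real \<epsilon> \<cdot>\<^sub>m W i)) /
        Re (tr (complex_of_real Lam \<cdot>\<^sub>m Wsum - complex_of_real \<epsilon> \<cdot>\<^sub>m Wsum))"
    and rho: "\<forall>i\<in>{1..n}. \<rho> i =
        (1 / tr (complex_of_real (lam i) \<cdot>\<^sub>m Wsum - complex_of_real \<epsilon> \<cdot>\<^sub>m W i)) \<cdot>\<^sub>m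
          (complex_of_real (lam i) \<cdot>\<^sub>m Wsum - complex_of_real \<epsilon> \<cdot>\<^sub>m W i)"
begin

abbreviation "N \<equiv> prod_list d"
abbreviation "X i \<equiv> complex_of_real (lam i) \<cdot>\<^sub>m Wsum - complex_of_real \<epsilon> \<cdot>\<^sub>m W i"
abbreviation "T \<equiv> Re (tr Wsum)"

section \<open>Positive definiteness of the sum of the witnesses\<close>

lemma N_pos: "0 < N"
proof -
  have "0 \<notin> set d" using dims by (metis in_set_conv_nth less_irrefl)
  then have "N \<noteq> 0" by (simp only: prod_list_zero_iff not_False_eq_True)
  then show ?thesis by (simp only: neq0_conv)
qed

lemma W_block: "i \<in> {1..n} \<Longrightarrow> W i \<in> block_positive d"
  using W by (auto simp: witnesses_def)

lemma W_herm: "i \<in> {1..n} \<Longrightarrow> W i \<in> herm N"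
  by (rule block_positive_herm[OF W_block])

lemmas W_carrier = herm_carrier[OF W_herm]

text \<open>A vector of strictly negative form is the only shape in which the non-positivity of a
  witness enters the argument.\<close>

lemma W_neg:
  assumes "i \<in> {1..n}"
  obtains v where "v \<in> carrier_vec N" "qform (W i) v < 0"
proof -
  have "W i \<notin> psd N" using W assms by (simp add: witnesses_def)
  then show ?thesis using that W_herm[OF assms] by (auto simp: psd_iff_qform not_le)
qed

lemma Wsum_herm: "Wsum \<in> herm N"
  unfolding Wsum using W_herm by (intro msum_closed[of _ _ _ N]) (auto simp: herm_add herm_carrier)

lemmas Wsum_carrier = herm_carrier[OF Wsum_herm]

lemma qform_Wsum_ge: "v \<in> carrier_vec N \<Longrightarrow> \<epsilon> * Re (v \<bullet>c v) \<le> qform Wsum v"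
  unfolding eps(1) by (rule min_eig_le_qform[OF Wsum_herm])

lemma qform_Wsum_pos: "v \<in> carrier_vec N \<Longrightarrow> v \<noteq> 0\<^sub>v N \<Longrightarrow> 0 < qform Wsum v"
  by (rule less_le_trans[OF mult_pos_pos[OF eps(2) cscalar_self_pos] qform_Wsum_ge])

lemma Wsum_psd: "Wsum \<in> psd N"
proof -
  have "0 \<le> qform Wsum v" if "v \<in> carrier_vec N" for v
    using qform_Wsum_ge[OF that] cscalar_self_nonneg[of v] eps(2)
      mult_nonneg_nonneg[of \<epsilon> "Re (v \<bullet>c v)"] by linarith
  then show ?thesis using Wsum_herm by (simp add: psd_iff_qform)
qed

lemma T_pos: "0 < T"
proof (rule ccontr)
  assume "\<not> 0 < T"
  then have "T = 0" using tr_psd_nonneg[OF Wsum_psd] by linarith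
  then have W0: "Wsum = 0\<^sub>m N N" by (rule psd_tr_zero[OF Wsum_psd])
  \<comment> \<open>The eigenvector merely serves as a nonzero vector, at which the form of
    \<open>Wsum\<close> is positive.\<close>
  obtain v where v: "v \<in> carrier_vec N" "v \<noteq> 0\<^sub>v N" "qform Wsum v = min_eig Wsum * Re (v \<bullet>c v)"
    by (rule min_eig_eigenvector[OF Wsum_herm N_pos])
  then show False using qform_Wsum_pos[OF v(1,2)] qform_zero[OF v(1)] by (simp add: W0)
qed

text \<open>An empty family would sum to the zero operator, of trace zero. This makes the sum in
  \<open>Lam_gt\<close> strictly positive.\<close>

lemma n_pos: "{1..n} \<noteq> {}"
proof
  assume "{1..n} = {}"
  then have "tr Wsum = 0" unfolding Wsum by (simp only: msum_empty) (simp add: tr_def)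
  then show False using T_pos by simp
qed

text \<open>If \<open>lam i\<close> were at most 0, minus \<open>W i\<close> would be positive, and
  by \<open>witness_tr_nonneg\<close> its trace would be at most 0. It would then vanish, although
  \<open>W i\<close> is negative at some vector.\<close>

lemma lam_pos:
  assumes i: "i \<in> {1..n}" shows "0 < lam i"
proof (rule ccontr)
  assume "\<not> 0 < lam i"
  then have le: "max_eig (W i) \<le> 0" using lam i by simp
  let ?V = "complex_of_real (-1) \<cdot>\<^sub>m W i"
  have "0 \<le> qform ?V v" if v: "v \<in> carrier_vec N" for v
    unfolding qform_smult[OF W_carrier[OF i] v]
    using qform_le_max_eig[OF W_herm[OF i] v] mult_nonpos_nonneg[OF le cscalar_self_nonneg[of v]]
    by linarith
  then have V: "?V \<in> psd N"
    using herm_smult[OF W_herm[OF i], of "-1"] by (simp add: psd_iff_qform)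
  have "Re (tr ?V) = - Re (tr (W i))"
    unfolding tr_smult[OF W_carrier[OF i]] by simp
  moreover have "0 \<le> Re (tr (W i))" using witness_tr_nonneg[OF _ dims] W i by blast
  ultimately have "Re (tr ?V) = 0" using tr_psd_nonneg[OF V] by linarith
  then have V0: "?V = 0\<^sub>m N N" by (rule psd_tr_zero[OF V])
  obtain v where v: "v \<in> carrier_vec N" "qform (W i) v < 0" by (rule W_neg[OF i])
  have "qform ?V v = 0" unfolding V0 by (rule qform_zero[OF v(1)])
  then show False using v(2) unfolding qform_smult[OF W_carrier[OF i] v(1)] by simp
qed

section \<open>The unnormalised operators of the ensemble\<close>

lemma X_herm: "i \<in> {1..n} \<Longrightarrow> X i \<in> herm N"
  by (intro herm_minus herm_smult Wsum_herm W_herm)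

lemma qform_X:
  assumes "i \<in> {1..n}" "v \<in> carrier_vec N"
  shows "qform (X i) v = lam i * qform Wsum v - \<epsilon> * qform (W i) v"
proof -
  have "qform (X i) v =
      qform (complex_of_real (lam i) \<cdot>\<^sub>m Wsum) v - qform (complex_of_real \<epsilon> \<cdot>\<^sub>m W i) v"
    by (rule qform_minus[OF _ _ assms(2)]) (intro smult_carrier_mat Wsum_carrier W_carrier assms(1))+
  then show ?thesis
    by (simp only: qform_smult[OF Wsum_carrier assms(2)] qform_smult[OF W_carrier[OF assms(1)] assms(2)])
qed

lemma X_psd:
  assumes i: "i \<in> {1..n}" shows "X i \<in> psd N"
proof -
  have "0 \<le> qform (X i) v" if v: "v \<in> carrier_vec N" for v
  proof -
    have "\<epsilon> * qform (W i) v \<le> \<epsilon> * (lam i * Re (v \<bullet>c v))"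
      using qform_le_max_eig[OF W_herm[OF i] v] lam i eps(2) by (intro mult_left_mono) auto
    also have "\<dots> = lam i * (\<epsilon> * Re (v \<bullet>c v))" by simp
    also have "\<dots> \<le> lam i * qform Wsum v"
      using qform_Wsum_ge[OF v] lam_pos[OF i] by (intro mult_left_mono) auto
    finally show ?thesis by (simp add: qform_X[OF i v])
  qed
  then show ?thesis using X_herm[OF i] by (simp add: psd_iff_qform)
qed

text \<open>A vanishing trace would force \<open>X i\<close> to be zero, yet at a vector where
  \<open>W i\<close> is negative the form of \<open>X i\<close> is positive. Hence
  \<open>\<eta> i\<close> is positive and the division in \<open>\<rho> i\<close> is
  genuine.\<close>

lemma tr_X_pos:
  assumes i: "i \<in> {1..n}" shows "0 < Re (tr (X i))"
proof (rule ccontr)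
  assume "\<not> 0 < Re (tr (X i))"
  then have "Re (tr (X i)) = 0" using tr_psd_nonneg[OF X_psd[OF i]] by linarith
  then have X0: "X i = 0\<^sub>m N N" by (rule psd_tr_zero[OF X_psd[OF i]])
  obtain v where v: "v \<in> carrier_vec N" "qform (W i) v < 0" by (rule W_neg[OF i])
  have "0 \<le> lam i * qform Wsum v"
    using lam_pos[OF i] Wsum_psd v(1) by (intro mult_nonneg_nonneg) (auto simp: psd_iff_qform)
  moreover have "\<epsilon> * qform (W i) v < 0" using v(2) eps(2) by (rule mult_pos_neg[rotated])
  ultimately have "0 < qform (X i) v" unfolding qform_X[OF i v(1)] by linarith
  then show False unfolding X0 using qform_zero[OF v(1)] by simp
qed

lemma tr_X: "i \<in> {1..n} \<Longrightarrow> tr (X i) = complex_of_real (Re (tr (X i)))"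
  using tr_herm_real[OF X_herm] by (simp add: complex_eq_iff)

lemma Re_tr_X:
  assumes "i \<in> {1..n}" shows "Re (tr (X i)) = lam i * T - \<epsilon> * Re (tr (W i))"
proof -
  have "tr (X i) = complex_of_real (lam i) * tr Wsum - complex_of_real \<epsilon> * tr (W i)"
    using tr_minus[of "complex_of_real (lam i) \<cdot>\<^sub>m Wsum" N "complex_of_real \<epsilon> \<cdot>\<^sub>m W i"]
      Wsum_carrier W_carrier[OF assms] tr_smult[OF Wsum_carrier] tr_smult[OF W_carrier[OF assms]]
    by simp
  then show ?thesis by simp
qed

lemma tr_denominator:
  "Re (tr (complex_of_real Lam \<cdot>\<^sub>m Wsum - complex_of_real \<epsilon> \<cdot>\<^sub>m Wsum)) = (Lam - \<epsilon>) * T"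
proof -
  have "tr (complex_of_real Lam \<cdot>\<^sub>m Wsum - complex_of_real \<epsilon> \<cdot>\<^sub>m Wsum) =
      complex_of_real Lam * tr Wsum - complex_of_real \<epsilon> * tr Wsum"
    using tr_minus[of "complex_of_real Lam \<cdot>\<^sub>m Wsum" N "complex_of_real \<epsilon> \<cdot>\<^sub>m Wsum"]
      Wsum_carrier tr_smult[OF Wsum_carrier] by simp
  then have "Re (tr (complex_of_real Lam \<cdot>\<^sub>m Wsum - complex_of_real \<epsilon> \<cdot>\<^sub>m Wsum)) = Lam * T - \<epsilon> * T"
    by simp
  then show ?thesis by (simp only: left_diff_distrib)
qed

lemma sum_tr_X: "(\<Sum>i\<in>{1..n}. Re (tr (X i))) = (Lam - \<epsilon>) * T"
proof -
  have "(\<Sum>i\<in>{1..n}. Re (tr (X i))) = (\<Sum>i\<in>{1..n}. lam i * T - \<epsilon> * Re (tr (W i)))"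
    by (rule sum.cong[OF refl Re_tr_X])
  also have "\<dots> = Lam * T - \<epsilon> * (\<Sum>i\<in>{1..n}. Re (tr (W i)))"
    by (simp only: sum_subtractf Lam sum_distrib_left sum_distrib_right)
  also have "(\<Sum>i\<in>{1..n}. Re (tr (W i))) = T"
    unfolding Wsum using W_carrier by (subst tr_msum) auto
  finally show ?thesis by (simp add: algebra_simps)
qed

text \<open>The positive traces of the \<open>X i\<close> add up to
  \<open>(Lam - \<epsilon>) * T\<close>, where \<open>T\<close> is positive.\<close>

lemma Lam_gt: "\<epsilon> < Lam"
proof -
  have "0 < (\<Sum>i\<in>{1..n}. Re (tr (X i)))"
    using n_pos tr_X_pos by (intro sum_pos) auto
  then show ?thesis using T_pos unfolding sum_tr_X by (simp add: zero_less_mult_iff)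
qed

lemma denominator_pos: "0 < (Lam - \<epsilon>) * T"
  using Lam_gt T_pos by simp

section \<open>The ensemble and its average state\<close>

lemma eta_eq: "i \<in> {1..n} \<Longrightarrow> \<eta> i = Re (tr (X i)) / ((Lam - \<epsilon>) * T)"
  unfolding tr_denominator[symmetric] by (rule bspec[OF eta])

lemma rho_eq:
  assumes i: "i \<in> {1..n}"
  shows "\<rho> i = complex_of_real (1 / Re (tr (X i))) \<cdot>\<^sub>m X i"
proof -
  have "1 / tr (X i) = complex_of_real (1 / Re (tr (X i)))"
    by (subst tr_X[OF i]) (simp only: of_real_divide of_real_1)
  then show ?thesis using bspec[OF rho i] by (simp only:)
qed

lemma rho_state:
  assumes i: "i \<in> {1..n}" shows "\<rho> i \<in> states N"
proof -
  have "\<rho> i \<in> psd N"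
    unfolding rho_eq[OF i] using tr_X_pos[OF i] by (intro psd_smult X_psd i) simp
  moreover have "tr (\<rho> i) = 1"
    unfolding rho_eq[OF i] tr_smult[OF herm_carrier[OF X_herm[OF i]]]
    using tr_X_pos[OF i] by (subst (2) tr_X[OF i]) (simp del: minus_complex.sel flip: of_real_mult)
  ultimately show ?thesis by (simp add: states_def)
qed

lemma ensemble: "ensemble d n \<eta> \<rho>"
  unfolding ensemble_def
proof (intro conjI ballI)
  show "0 < \<eta> i" if "i \<in> {1..n}" for i
    unfolding eta_eq[OF that] by (intro divide_pos_pos tr_X_pos[OF that] denominator_pos)
  show "\<rho> i \<in> states N" if "i \<in> {1..n}" for i by (rule rho_state[OF that])
  have "(\<Sum>i\<in>{1..n}. \<eta> i) = (\<Sum>i\<in>{1..n}. Re (tr (X i))) / ((Lam - \<epsilon>) * T)"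
    unfolding sum_divide_distrib by (rule sum.cong[OF refl eta_eq])
  then show "(\<Sum>i\<in>{1..n}. \<eta> i) = 1"
    unfolding sum_tr_X using denominator_pos by (metis divide_self less_irrefl)
qed

text \<open>The trace of \<open>X i\<close> cancels between probability and state, so the prefactor
  is the same for all \<open>i\<close>.\<close>

lemma eta_rho_eq:
  assumes i: "i \<in> {1..n}"
  shows "complex_of_real (\<eta> i) \<cdot>\<^sub>m \<rho> i = complex_of_real (1 / ((Lam - \<epsilon>) * T)) \<cdot>\<^sub>m X i"
proof -
  have "complex_of_real (\<eta> i) \<cdot>\<^sub>m \<rho> i = complex_of_real (\<eta> i * (1 / Re (tr (X i)))) \<cdot>\<^sub>m X i"
    unfolding rho_eq[OF i] by (intro eq_matI) auto
  also have "\<eta> i * (1 / Re (tr (X i))) = 1 / ((Lam - \<epsilon>) * T)"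
    unfolding eta_eq[OF i] using tr_X_pos[OF i] by simp
  finally show ?thesis .
qed

lemma avg_state_eq: "avg_state d n \<eta> \<rho> = complex_of_real (1 / T) \<cdot>\<^sub>m Wsum"
proof (rule eq_matI)
  fix a b assume "a < dim_row (complex_of_real (1 / T) \<cdot>\<^sub>m Wsum)"
    "b < dim_col (complex_of_real (1 / T) \<cdot>\<^sub>m Wsum)"
  then have ab: "a < N" "b < N" using Wsum_carrier by auto
  define \<kappa> where "\<kappa> = (Lam - \<epsilon>) * T"
  have "avg_state d n \<eta> \<rho> $$ (a, b) = (\<Sum>i\<in>{1..n}. (complex_of_real (\<eta> i) \<cdot>\<^sub>m \<rho> i) $$ (a, b))"
    using ab by (simp add: avg_state_def msum_def)
  also have "\<dots> = (\<Sum>i\<in>{1..n}. complex_of_real (1 / \<kappa>) *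
      (complex_of_real (lam i) * Wsum $$ (a, b) - complex_of_real \<epsilon> * W i $$ (a, b)))"
  proof (rule sum.cong[OF refl])
    fix i assume i: "i \<in> {1..n}"
    show "(complex_of_real (\<eta> i) \<cdot>\<^sub>m \<rho> i) $$ (a, b) = complex_of_real (1 / \<kappa>) *
        (complex_of_real (lam i) * Wsum $$ (a, b) - complex_of_real \<epsilon> * W i $$ (a, b))"
      unfolding eta_rho_eq[OF i] \<kappa>_def[symmetric] using ab Wsum_carrier W_carrier[OF i] by auto
  qed
  \<comment> \<open>The \<open>lam i\<close> add up to \<open>Lam\<close> and the witnesses to
    \<open>Wsum\<close>; the resulting factor \<open>Lam - \<epsilon>\<close> cancels against
    \<open>\<kappa>\<close>.\<close>
  also have "\<dots> = complex_of_real (1 / \<kappa>) *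
      (complex_of_real Lam * Wsum $$ (a, b) - complex_of_real \<epsilon> * (\<Sum>i\<in>{1..n}. W i $$ (a, b)))"
    by (simp only: sum_distrib_left sum_distrib_right sum_subtractf Lam of_real_sum right_diff_distrib)
  also have "(\<Sum>i\<in>{1..n}. W i $$ (a, b)) = Wsum $$ (a, b)"
    using ab by (simp add: Wsum msum_def)
  also have "complex_of_real (1 / \<kappa>) *
      (complex_of_real Lam * Wsum $$ (a, b) - complex_of_real \<epsilon> * Wsum $$ (a, b)) =
      complex_of_real (1 / \<kappa> * (Lam - \<epsilon>)) * Wsum $$ (a, b)"
    by (simp add: left_diff_distrib)
  also have "1 / \<kappa> * (Lam - \<epsilon>) = 1 / T"
    unfolding \<kappa>_def using Lam_gt by simp
  finally show "avg_state d n \<eta> \<rho> $$ (a, b) = (complex_of_real (1 / T) \<cdot>\<^sub>m Wsum) $$ (a, b)"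
    using ab Wsum_carrier by simp
qed (use Wsum_carrier in \<open>auto simp: avg_state_def msum_def\<close>)

section \<open>Traces against the ensemble and the confidence\<close>

lemma tr_avg_mult:
  assumes "M \<in> carrier_mat N N"
  shows "Re (tr (avg_state d n \<eta> \<rho> * M)) = Re (tr (Wsum * M)) / T"
  unfolding avg_state_eq Re_tr_smult_mult[OF Wsum_carrier assms] by simp

lemma tr_eta_rho_mult:
  assumes j: "j \<in> {1..n}" and M: "M \<in> carrier_mat N N"
  shows "Re (tr ((complex_of_real (\<eta> j) \<cdot>\<^sub>m \<rho> j) * M)) =
    (lam j * Re (tr (Wsum * M)) - \<epsilon> * Re (tr (W j * M))) / ((Lam - \<epsilon>) * T)"
proof -
  have "Re (tr (X j * M)) = lam j * Re (tr (Wsum * M)) - \<epsilon> * Re (tr (W j * M))"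
    using Re_tr_minus_mult[of "complex_of_real (lam j) \<cdot>\<^sub>m Wsum" N "complex_of_real \<epsilon> \<cdot>\<^sub>m W j" M]
      Wsum_carrier W_carrier[OF j] M
    by (simp add: Re_tr_smult_mult[OF Wsum_carrier M] Re_tr_smult_mult[OF W_carrier[OF j] M])
  then show ?thesis
    unfolding eta_rho_eq[OF j] Re_tr_smult_mult[OF herm_carrier[OF X_herm[OF j]] M] by simp
qed

lemma confidence_eq:
  assumes j: "j \<in> {1..n}" and M: "M j \<in> psd N" and nz: "tr (avg_state d n \<eta> \<rho> * M j) \<noteq> 0"
  shows "0 < Re (tr (Wsum * M j))"
    and "confidence d n \<eta> \<rho> j M =
      (lam j - \<epsilon> * (Re (tr (W j * M j)) / Re (tr (Wsum * M j)))) / (Lam - \<epsilon>)"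
proof -
  have Mc: "M j \<in> carrier_mat N N" by (rule psd_carrier[OF M])
  \<comment> \<open>The hypothesis excludes only a zero complex trace. A product of two Hermitian
    matrices has real trace, so the real part in the denominator is nonzero as well.\<close>
  have "Im (tr (avg_state d n \<eta> \<rho> * M j)) = 0"
    unfolding avg_state_eq
    by (rule tr_mult_herm_real[OF herm_smult[OF Wsum_herm] psd_herm[OF M]])
  then have "Re (tr (avg_state d n \<eta> \<rho> * M j)) \<noteq> 0" using nz by (auto simp: complex_eq_iff)
  then have "Re (tr (Wsum * M j)) \<noteq> 0" unfolding tr_avg_mult[OF Mc] by auto
  then show pos: "0 < Re (tr (Wsum * M j))" using tr_mult_psd_nonneg[OF Wsum_psd M] by linarith
  have "\<eta> j * Re (tr (\<rho> j * M j)) = Re (tr ((complex_of_real (\<eta> j) \<cdot>\<^sub>m \<rho> j) * M j))"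
    using Re_tr_smult_mult[OF psd_carrier[OF states_psd[OF rho_state[OF j]]] Mc] by simp
  then have "\<eta> j * Re (tr (\<rho> j * M j)) =
      (lam j * Re (tr (Wsum * M j)) - \<epsilon> * Re (tr (W j * M j))) / ((Lam - \<epsilon>) * T)"
    by (simp only: tr_eta_rho_mult[OF j Mc])
  moreover have "(lam j * a - \<epsilon> * b) / ((Lam - \<epsilon>) * T) / (a / T) =
      (lam j - \<epsilon> * (b / a)) / (Lam - \<epsilon>)" if "0 < a" for a b
  proof -
    have "(lam j * a - \<epsilon> * b) / ((Lam - \<epsilon>) * T) / (a / T) = ((lam j * a - \<epsilon> * b) / a) / (Lam - \<epsilon>)"
      using that T_pos by simp
    also have "(lam j * a - \<epsilon> * b) / a = lam j - \<epsilon> * (b / a)"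
      using that by (simp add: diff_divide_distrib)
    finally show ?thesis .
  qed
  ultimately show "confidence d n \<eta> \<rho> j M =
      (lam j - \<epsilon> * (Re (tr (W j * M j)) / Re (tr (Wsum * M j)))) / (Lam - \<epsilon>)"
    unfolding confidence_def tr_avg_mult[OF Mc] using pos by (simp only:)
qed

section \<open>The bound Q as an optimal ratio over separable operators\<close>

lemma Q_bound_eq:
  assumes j: "j \<in> {1..n}"
  shows "Q_bound d n \<eta> \<rho> j = (LEAST q. \<forall>F\<in>SEP d.
    Re (tr ((complex_of_real (\<eta> j) \<cdot>\<^sub>m \<rho> j) * F)) \<le> q * Re (tr (avg_state d n \<eta> \<rho> * F)))"
proof -
  have avg: "avg_state d n \<eta> \<rho> \<in> herm N"
    unfolding avg_state_eq by (rule herm_smult[OF Wsum_herm])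
  have rho: "complex_of_real (\<eta> j) \<cdot>\<^sub>m \<rho> j \<in> herm N"
    by (rule herm_smult[OF psd_herm[OF states_psd[OF rho_state[OF j]]]])
  have "complex_of_real q \<cdot>\<^sub>m avg_state d n \<eta> \<rho> - complex_of_real (\<eta> j) \<cdot>\<^sub>m \<rho> j \<in> block_positive d \<longleftrightarrow>
      (\<forall>F\<in>SEP d. Re (tr ((complex_of_real (\<eta> j) \<cdot>\<^sub>m \<rho> j) * F)) \<le> q * Re (tr (avg_state d n \<eta> \<rho> * F)))"
    for q
  proof -
    have "Re (tr ((complex_of_real q \<cdot>\<^sub>m avg_state d n \<eta> \<rho> - complex_of_real (\<eta> j) \<cdot>\<^sub>m \<rho> j) * F)) =
        q * Re (tr (avg_state d n \<eta> \<rho> * F)) - Re (tr ((complex_of_real (\<eta> j) \<cdot>\<^sub>m \<rho> j) * F))"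
      if "F \<in> SEP d" for F
      using Re_tr_minus_mult[OF herm_carrier[OF herm_smult[OF avg]] herm_carrier[OF rho]
          SEP_carrier[OF that], of q]
        Re_tr_smult_mult[OF herm_carrier[OF avg] SEP_carrier[OF that]] by simp
    then show ?thesis
      using herm_minus[OF herm_smult[OF avg, of q] rho] by (simp add: block_positive_def)
  qed
  then show ?thesis by (simp add: Q_bound_def)
qed

text \<open>The right side exceeds the left by
  \<open>\<epsilon> * Re (tr (W j * F)) / ((Lam - \<epsilon>) * T)\<close>, nonnegative by block
  positivity.\<close>

lemma separable_bound:
  assumes j: "j \<in> {1..n}" and F: "F \<in> SEP d"
  shows "Re (tr ((complex_of_real (\<eta> j) \<cdot>\<^sub>m \<rho> j) * F)) \<le>
    lam j / (Lam - \<epsilon>) * Re (tr (avg_state d n \<eta> \<rho> * F))"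
proof -
  have "lam j / (Lam - \<epsilon>) * (Re (tr (Wsum * F)) / T) =
      lam j * Re (tr (Wsum * F)) / ((Lam - \<epsilon>) * T)"
    by simp
  moreover have "0 \<le> \<epsilon> * Re (tr (W j * F))"
    using block_positive_SEP[OF W_block[OF j] F] eps(2) by simp
  ultimately show ?thesis
    unfolding tr_avg_mult[OF SEP_carrier[OF F]] tr_eta_rho_mult[OF j SEP_carrier[OF F]]
    using denominator_pos by (simp add: divide_right_mono)
qed

lemma Q_bound_props:
  assumes j: "j \<in> {1..n}"
  shows "Q_bound d n \<eta> \<rho> j \<le> lam j / (Lam - \<epsilon>)"
    and "\<And>F. F \<in> SEP d \<Longrightarrow> Re (tr ((complex_of_real (\<eta> j) \<cdot>\<^sub>m \<rho> j) * F)) \<le>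
      Q_bound d n \<eta> \<rho> j * Re (tr (avg_state d n \<eta> \<rho> * F))"
proof -
  have nonneg: "0 \<le> Re (tr (avg_state d n \<eta> \<rho> * F))" if F: "F \<in> SEP d" for F
    unfolding tr_avg_mult[OF SEP_carrier[OF F]]
    using tr_mult_psd_nonneg[OF Wsum_psd SEP_psd[OF F]] T_pos by simp
  \<comment> \<open>The identity is the separable operator of positive trace that bounds the
    admissible values from below.\<close>
  have one: "0 < Re (tr (avg_state d n \<eta> \<rho> * 1\<^sub>m N))"
    unfolding tr_avg_mult[OF one_carrier_mat] right_mult_one_mat[OF Wsum_carrier]
    using T_pos by simp
  note least = least_ratio_bound[of "SEP d" "\<lambda>F. Re (tr (avg_state d n \<eta> \<rho> * F))",
      OF nonneg SEP_one[OF dims] one separable_bound[OF j]]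
  show "Q_bound d n \<eta> \<rho> j \<le> lam j / (Lam - \<epsilon>)"
    unfolding Q_bound_eq[OF j] by (rule least(1))
  show "Re (tr ((complex_of_real (\<eta> j) \<cdot>\<^sub>m \<rho> j) * F)) \<le>
      Q_bound d n \<eta> \<rho> j * Re (tr (avg_state d n \<eta> \<rho> * F))" if "F \<in> SEP d" for F
    unfolding Q_bound_eq[OF j] by (rule least(2)[OF _ _ that])
qed

text \<open>At a separable state orthogonal to \<open>W j\<close> the inequality in
  \<open>Q_bound_props\<close> loses its witness term and turns into the missing lower
  bound.\<close>

lemma Q_bound_weakly_optimal:
  assumes j: "j \<in> {1..n}" and opt: "weakly_optimal d (W j)"
  shows "Q_bound d n \<eta> \<rho> j = lam j / (Lam - \<epsilon>)"
proof -
  obtain \<sigma> where \<sigma>: "\<sigma> \<in> SEP d" "tr \<sigma> = 1" "tr (\<sigma> * W j) = 0"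
    using opt by (auto simp: weakly_optimal_def)
  have c: "\<sigma> \<in> carrier_mat N N" by (rule SEP_carrier[OF \<sigma>(1)])
  have "tr (W j * \<sigma>) = 0" using tr_mult_comm[OF W_carrier[OF j] c] \<sigma>(3) by simp
  then have b: "Re (tr (W j * \<sigma>)) = 0" by simp
  \<comment> \<open>Tested on \<open>\<sigma>\<close>, of trace 1, positivity of \<open>Wsum\<close>
    minus \<open>\<epsilon>\<close> times the identity gives a trace of
    \<open>Wsum * \<sigma>\<close> of at least \<open>\<epsilon>\<close>, so this trace can be
    cancelled.\<close>
  have "0 \<le> qform (Wsum - complex_of_real \<epsilon> \<cdot>\<^sub>m 1\<^sub>m N) v" if v: "v \<in> carrier_vec N" for v
    using qform_minus[OF Wsum_carrier _ v, of "complex_of_real \<epsilon> \<cdot>\<^sub>m 1\<^sub>m N"]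
      qform_smult[OF one_carrier_mat v] qform_one[OF v] qform_Wsum_ge[OF v] by simp
  then have "Wsum - complex_of_real \<epsilon> \<cdot>\<^sub>m 1\<^sub>m N \<in> psd N"
    using herm_minus[OF Wsum_herm herm_smult[OF herm_one]] by (simp add: psd_iff_qform)
  then have "0 \<le> Re (tr ((Wsum - complex_of_real \<epsilon> \<cdot>\<^sub>m 1\<^sub>m N) * \<sigma>))"
    by (rule tr_mult_psd_nonneg[OF _ SEP_psd[OF \<sigma>(1)]])
  also have "\<dots> = Re (tr (Wsum * \<sigma>)) - \<epsilon>"
    using Re_tr_minus_mult[OF Wsum_carrier _ c, of "complex_of_real \<epsilon> \<cdot>\<^sub>m 1\<^sub>m N"]
      Re_tr_smult_mult[OF one_carrier_mat c] c \<sigma>(2) by simp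
  finally have a: "0 < Re (tr (Wsum * \<sigma>))" using eps(2) by linarith
  have "lam j * Re (tr (Wsum * \<sigma>)) / ((Lam - \<epsilon>) * T) \<le>
      Q_bound d n \<eta> \<rho> j * (Re (tr (Wsum * \<sigma>)) / T)"
    using Q_bound_props(2)[OF j \<sigma>(1)]
    unfolding tr_avg_mult[OF c] tr_eta_rho_mult[OF j c] b by simp
  then have "(lam j / (Lam - \<epsilon>)) * (Re (tr (Wsum * \<sigma>)) / T) \<le>
      Q_bound d n \<eta> \<rho> j * (Re (tr (Wsum * \<sigma>)) / T)"
    by simp
  then have "lam j / (Lam - \<epsilon>) \<le> Q_bound d n \<eta> \<rho> j"
    by (rule mult_right_le_imp_le) (use a T_pos in simp)
  then show ?thesis using Q_bound_props(1)[OF j] by simp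
qed

section \<open>Congruence with the inverse square root\<close>

abbreviation "S \<equiv> psd_sqrt Wsum"
abbreviation "R \<equiv> minv S"
text \<open>Its eigenvalues are the generalised eigenvalues of the pair \<open>W j\<close> and
  \<open>Wsum\<close>.\<close>

abbreviation "A j \<equiv> R * W j * R"

lemma S_psd: "S \<in> psd N" and S_square: "S * S = Wsum"
  using psd_sqrt_psd[OF Wsum_psd] by auto

lemmas S_carrier = psd_carrier[OF S_psd]

text \<open>The kernel of \<open>S\<close> lies in that of \<open>S * S = Wsum\<close>, which is
  positive definite.\<close>

lemma S_injective:
  assumes v: "v \<in> carrier_vec N" and 0: "S *\<^sub>v v = 0\<^sub>v N"
  shows "v = 0\<^sub>v N"
proof (rule ccontr)
  assume "v \<noteq> 0\<^sub>v N"
  then have pos: "0 < qform Wsum v" by (rule qform_Wsum_pos[OF v])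
  have "Wsum *\<^sub>v v = S *\<^sub>v (S *\<^sub>v v)"
    using assoc_mult_mat_vec[OF S_carrier S_carrier v] by (simp only: S_square)
  moreover have "S *\<^sub>v 0\<^sub>v N = 0\<^sub>v N"
    using S_carrier by (intro eq_vecI) auto
  ultimately have "Wsum *\<^sub>v v = 0\<^sub>v N" by (simp only: 0)
  then have "qform Wsum v = 0" using v by (simp add: qform_def)
  then show False using pos by simp
qed

lemma R_carrier: "R \<in> carrier_mat N N" and SR: "S * R = 1\<^sub>m N" and RS: "R * S = 1\<^sub>m N"
  using minv_inverse[OF S_carrier S_injective] by auto

lemma R_herm: "R \<in> herm N"
  by (rule inverse_herm[OF psd_herm[OF S_psd] R_carrier SR RS])

lemma A_herm: "j \<in> {1..n} \<Longrightarrow> A j \<in> herm N"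
  using herm_congruence[OF W_herm R_carrier] by (simp add: herm_adjoint[OF R_herm])

lemma qform_A:
  "j \<in> {1..n} \<Longrightarrow> v \<in> carrier_vec N \<Longrightarrow> qform (A j) v = qform (W j) (R *\<^sub>v v)"
  using qform_congruence[OF W_carrier R_carrier] by (simp add: herm_adjoint[OF R_herm])

lemma RS_vec: "v \<in> carrier_vec N \<Longrightarrow> R *\<^sub>v (S *\<^sub>v v) = v"
  using assoc_mult_mat_vec[OF R_carrier S_carrier] by (simp add: RS)

lemma SR_vec: "v \<in> carrier_vec N \<Longrightarrow> S *\<^sub>v (R *\<^sub>v v) = v"
  using assoc_mult_mat_vec[OF S_carrier R_carrier] by (simp add: SR)

lemma qform_Wsum:
  assumes v: "v \<in> carrier_vec N"
  shows "qform Wsum v = Re ((S *\<^sub>v v) \<bullet>c (S *\<^sub>v v))"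
proof -
  have "mat_adjoint S * 1\<^sub>m N * S = Wsum"
    using S_square right_mult_one_mat[OF S_carrier] by (simp add: herm_adjoint[OF psd_herm[OF S_psd]])
  then show ?thesis
    using qform_congruence[OF one_carrier_mat S_carrier v] qform_one[OF mult_mat_vec_carrier[OF S_carrier v]]
    by simp
qed

text \<open>Evaluate the eigenvalue bound for \<open>A j\<close> at \<open>S *\<^sub>v v\<close>:
  there its form is that of \<open>W j\<close> at \<open>v\<close>, and the squared norm is the form
  of \<open>Wsum\<close> at \<open>v\<close>.\<close>

lemma qform_W_ge:
  assumes j: "j \<in> {1..n}" and v: "v \<in> carrier_vec N"
  shows "min_eig (A j) * qform Wsum v \<le> qform (W j) v"
  using min_eig_le_qform[OF A_herm[OF j] mult_mat_vec_carrier[OF S_carrier v]]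
  unfolding qform_A[OF j mult_mat_vec_carrier[OF S_carrier v]] RS_vec[OF v] qform_Wsum[OF v] .

text \<open>By \<open>qform_W_ge\<close>, a nonnegative smallest eigenvalue would make
  \<open>W j\<close> positive.\<close>

lemma min_eig_A_neg:
  assumes j: "j \<in> {1..n}" shows "min_eig (A j) < 0"
proof (rule ccontr)
  assume "\<not> min_eig (A j) < 0"
  moreover obtain v where v: "v \<in> carrier_vec N" "qform (W j) v < 0" by (rule W_neg[OF j])
  moreover have "0 \<le> qform Wsum v" using Wsum_psd v(1) by (simp add: psd_iff_qform)
  ultimately show False using qform_W_ge[OF j v(1)] mult_nonneg_nonneg[of "min_eig (A j)" "qform Wsum v"]
    by linarith
qed

section \<open>Maximum confidence over all measurements and over LOCC\<close>

lemma tr_W_ge: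
  assumes j: "j \<in> {1..n}" and M: "M \<in> psd N"
  shows "min_eig (A j) * Re (tr (Wsum * M)) \<le> Re (tr (W j * M))"
proof -
  let ?c = "min_eig (A j)"
  have Mc: "M \<in> carrier_mat N N" by (rule psd_carrier[OF M])
  have sW: "complex_of_real ?c \<cdot>\<^sub>m Wsum \<in> herm N" by (rule herm_smult[OF Wsum_herm])
  \<comment> \<open>The inequality of forms makes the difference a positive operator, and its trace
    against the positive \<open>M\<close> is nonnegative.\<close>
  have "0 \<le> qform (W j - complex_of_real ?c \<cdot>\<^sub>m Wsum) v" if v: "v \<in> carrier_vec N" for v
    using qform_minus[OF W_carrier[OF j] herm_carrier[OF sW] v] qform_smult[OF Wsum_carrier v]
      qform_W_ge[OF j v] by simp
  then have "W j - complex_of_real ?c \<cdot>\<^sub>m Wsum \<in> psd N"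
    using herm_minus[OF W_herm[OF j] sW] by (simp add: psd_iff_qform)
  then have "0 \<le> Re (tr ((W j - complex_of_real ?c \<cdot>\<^sub>m Wsum) * M))"
    by (rule tr_mult_psd_nonneg[OF _ M])
  then show ?thesis
    using Re_tr_minus_mult[OF W_carrier[OF j] herm_carrier[OF sW] Mc]
      Re_tr_smult_mult[OF Wsum_carrier Mc] by simp
qed

text \<open>The parameter \<open>c\<close> serves both bounds: it is the smallest eigenvalue of
  \<open>A j\<close> for arbitrary measurements and 0 for LOCC ones.\<close>

lemma confidence_le:
  assumes j: "j \<in> {1..n}" and M: "M j \<in> psd N" and nz: "tr (avg_state d n \<eta> \<rho> * M j) \<noteq> 0"
    and c: "c * Re (tr (Wsum * M j)) \<le> Re (tr (W j * M j))"
  shows "confidence d n \<eta> \<rho> j M \<le> (lam j - \<epsilon> * c) / (Lam - \<epsilon>)"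
proof -
  note conf = confidence_eq[OF j, of M, OF M nz]
  have "\<epsilon> * c \<le> \<epsilon> * (Re (tr (W j * M j)) / Re (tr (Wsum * M j)))"
    using c conf(1) eps(2) by (intro mult_left_mono) (simp_all add: le_divide_eq)
  then show ?thesis
    unfolding conf(2) using Lam_gt by (intro divide_right_mono) auto
qed

text \<open>Pulling the eigenvector back by \<open>R\<close> turns the forms of \<open>Wsum\<close>
  and \<open>W j\<close> at \<open>u\<close> into the squared norm of \<open>v\<close> and the form
  of \<open>A j\<close> at \<open>v\<close>, whose ratio is the smallest eigenvalue.\<close>

lemma confidence_attained:
  assumes j: "j \<in> {1..n}"
  obtains M where "measurement d n M" "tr (avg_state d n \<eta> \<rho> * M j) \<noteq> 0"
    "confidence d n \<eta> \<rho> j M = (lam j - \<epsilon> * min_eig (A j)) / (Lam - \<epsilon>)"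
proof -
  obtain v where v: "v \<in> carrier_vec N" "v \<noteq> 0\<^sub>v N"
    and ev: "qform (A j) v = min_eig (A j) * Re (v \<bullet>c v)"
    by (rule min_eig_eigenvector[OF A_herm[OF j] N_pos])
  define u where "u = R *\<^sub>v v"
  have u: "u \<in> carrier_vec N" unfolding u_def by (rule mult_mat_vec_carrier[OF R_carrier v(1)])
  have P: "outer u \<in> psd N" by (rule outer_psd[OF u])
  \<comment> \<open>Small enough to keep \<open>c\<close> times \<open>outer u\<close> below the
    identity; the denominator is positive whatever the eigenvalue. The confidence is a ratio, so
    \<open>c\<close> cancels in it.\<close>
  define c where "c = 1 / (1 + \<bar>max_eig (outer u)\<bar>)"
  have c: "0 < c" "c * max_eig (outer u) \<le> 1" by (auto simp: c_def divide_le_eq)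
  define E where "E = complex_of_real c \<cdot>\<^sub>m outer u"
  have E: "E \<in> psd N" unfolding E_def using c(1) by (intro psd_smult[OF P]) simp
  have Ec: "E \<in> carrier_mat N N" by (rule psd_carrier[OF E])
  have "0 \<le> qform (1\<^sub>m N - E) x" if x: "x \<in> carrier_vec N" for x
  proof -
    have "qform E x = c * qform (outer u) x"
      unfolding E_def by (rule qform_smult[OF psd_carrier[OF P] x])
    also have "\<dots> \<le> c * (max_eig (outer u) * Re (x \<bullet>c x))"
      using qform_le_max_eig[OF psd_herm[OF P] x] c(1) by (intro mult_left_mono) auto
    also have "\<dots> = (c * max_eig (outer u)) * Re (x \<bullet>c x)" by simp
    also have "\<dots> \<le> 1 * Re (x \<bullet>c x)"
      using c(2) cscalar_self_nonneg by (intro mult_right_mono) auto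
    finally show ?thesis
      using qform_minus[OF one_carrier_mat Ec x] qform_one[OF x] by simp
  qed
  then have comp: "1\<^sub>m N - E \<in> psd N"
    using herm_minus[OF herm_one psd_herm[OF E]] by (simp add: psd_iff_qform)
  \<comment> \<open>The rest of the identity goes to outcome 0, which identifies no state. Since
    \<open>j\<close> is at least 1, the two outcomes are distinct.\<close>
  define M where "M i = (if i = j then E else if i = 0 then 1\<^sub>m N - E else 0\<^sub>m N N)" for i
  have "msum N M {0..n} = 1\<^sub>m N"
  proof (rule eq_matI)
    fix a b assume "a < dim_row (1\<^sub>m N)" "b < dim_col (1\<^sub>m N)"
    then have ab: "a < N" "b < N" by auto
    have j0: "0 \<in> {0..n} - {j}" "j \<noteq> 0" using j by auto
    have "msum N M {0..n} $$ (a, b) = (\<Sum>i\<in>{0..n}. M i $$ (a, b))"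
      using ab by (simp add: msum_def)
    also have "\<dots> = M j $$ (a, b) + (\<Sum>i\<in>{0..n} - {j}. M i $$ (a, b))"
      using j by (intro sum.remove) auto
    also have "(\<Sum>i\<in>{0..n} - {j}. M i $$ (a, b)) =
        M 0 $$ (a, b) + (\<Sum>i\<in>{0..n} - {j} - {0}. M i $$ (a, b))"
      using j0(1) by (intro sum.remove) auto
    also have "(\<Sum>i\<in>{0..n} - {j} - {0}. M i $$ (a, b)) = 0"
      using ab by (intro sum.neutral) (auto simp: M_def)
    also have "M j $$ (a, b) + (M 0 $$ (a, b) + 0) = 1\<^sub>m N $$ (a, b)"
      using ab Ec j0(2) by (auto simp: M_def)
    finally show "msum N M {0..n} $$ (a, b) = 1\<^sub>m N $$ (a, b)" .
  qed (auto simp: msum_def)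
  then have meas: "measurement d n M"
    using E comp by (simp add: measurement_def M_def)
  have Mj: "M j = E" by (simp add: M_def)
  have vv: "0 < Re (v \<bullet>c v)" by (rule cscalar_self_pos[OF v])
  have a: "Re (tr (Wsum * M j)) = c * Re (v \<bullet>c v)"
  proof -
    have "tr (Wsum * E) = complex_of_real c * tr (Wsum * outer u)"
      unfolding E_def mult_smult_distrib[OF Wsum_carrier psd_carrier[OF P]]
      by (rule tr_smult[OF mult_carrier_mat[OF Wsum_carrier psd_carrier[OF P]]])
    then have "Re (tr (Wsum * E)) = c * qform Wsum u"
      using tr_mult_outer[OF Wsum_carrier u] by simp
    also have "qform Wsum u = Re (v \<bullet>c v)"
      using qform_Wsum[OF u] SR_vec[OF v(1)] by (simp add: u_def)
    finally show ?thesis by (simp add: Mj)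
  qed
  have b: "Re (tr (W j * M j)) = c * (min_eig (A j) * Re (v \<bullet>c v))"
  proof -
    have "tr (W j * E) = complex_of_real c * tr (W j * outer u)"
      unfolding E_def mult_smult_distrib[OF W_carrier[OF j] psd_carrier[OF P]]
      by (rule tr_smult[OF mult_carrier_mat[OF W_carrier[OF j] psd_carrier[OF P]]])
    then have "Re (tr (W j * E)) = c * qform (W j) u"
      using tr_mult_outer[OF W_carrier[OF j] u] by simp
    also have "qform (W j) u = min_eig (A j) * Re (v \<bullet>c v)"
      using qform_A[OF j v(1)] ev by (simp add: u_def)
    finally show ?thesis by (simp add: Mj)
  qed
  have "Re (tr (avg_state d n \<eta> \<rho> * M j)) \<noteq> 0"
    unfolding tr_avg_mult[OF Ec[folded Mj]] a using c(1) vv T_pos by simp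
  then have nz: "tr (avg_state d n \<eta> \<rho> * M j) \<noteq> 0" by auto
  have "confidence d n \<eta> \<rho> j M = (lam j - \<epsilon> * min_eig (A j)) / (Lam - \<epsilon>)"
    using confidence_eq(2)[OF j, of M, OF _ nz] E a b c(1) vv by (simp add: Mj)
  then show ?thesis using that meas nz by blast
qed

lemma max_confidence_eq:
  assumes j: "j \<in> {1..n}"
  shows "max_confidence d n \<eta> \<rho> j = (lam j - \<epsilon> * min_eig (A j)) / (Lam - \<epsilon>)"
  unfolding max_confidence_def
proof (rule Greatest_equality)
  show "\<exists>M. measurement d n M \<and> tr (avg_state d n \<eta> \<rho> * M j) \<noteq> 0 \<and>
      (lam j - \<epsilon> * min_eig (A j)) / (Lam - \<epsilon>) = confidence d n \<eta> \<rho> j M"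
    using confidence_attained[OF j] by metis
next
  fix x assume "\<exists>M. measurement d n M \<and> tr (avg_state d n \<eta> \<rho> * M j) \<noteq> 0 \<and>
      x = confidence d n \<eta> \<rho> j M"
  then obtain M where M: "measurement d n M" "tr (avg_state d n \<eta> \<rho> * M j) \<noteq> 0"
    and x: "x = confidence d n \<eta> \<rho> j M" by blast
  have "M j \<in> psd N" using M(1) j by (simp add: measurement_def)
  then show "x \<le> (lam j - \<epsilon> * min_eig (A j)) / (Lam - \<epsilon>)"
    unfolding x using M(2) by (intro confidence_le[OF j, of M] tr_W_ge[OF j])
qed

lemma locc_max_confidence_le:
  assumes j: "j \<in> {1..n}"
  shows "locc_max_confidence d n \<eta> \<rho> j \<le> lam j / (Lam - \<epsilon>)"
  unfolding locc_max_confidence_def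
proof (rule cSup_least)
  \<comment> \<open>The supremum needs a nonempty set: announcing \<open>j\<close> without any round
    is an LOCC measurement with nonzero denominator.\<close>
  define M where "M i = (if i = j then 1\<^sub>m N else 0\<^sub>m N N :: complex mat)" for i
  have "msum N M {0..n} = 1\<^sub>m N"
  proof (rule eq_matI)
    fix a b assume "a < dim_row (1\<^sub>m N)" "b < dim_col (1\<^sub>m N)"
    then have ab: "a < N" "b < N" by auto
    have "msum N M {0..n} $$ (a, b) = (\<Sum>i\<in>{0..n}. if i = j then 1\<^sub>m N $$ (a, b) else 0)"
      using ab by (simp add: msum_def M_def if_distrib[of "\<lambda>A. A $$ _"] cong: if_cong)
    then show "msum N M {0..n} $$ (a, b) = 1\<^sub>m N $$ (a, b)" using j by simp
  qed (auto simp: msum_def)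
  then have "measurement d n M" by (simp add: measurement_def M_def)
  moreover have "locc_realizes n d M"
    unfolding M_def using j by (intro locc_realizes.announce) simp
  ultimately have "locc_measurement d n M" by (auto simp: locc_measurement_def)
  moreover have "Re (tr (avg_state d n \<eta> \<rho> * M j)) \<noteq> 0"
    unfolding M_def using T_pos
    by (simp add: tr_avg_mult[OF one_carrier_mat] right_mult_one_mat[OF Wsum_carrier])
  then have "tr (avg_state d n \<eta> \<rho> * M j) \<noteq> 0" by auto
  ultimately show "{confidence d n \<eta> \<rho> j M | M.
      locc_measurement d n M \<and> tr (avg_state d n \<eta> \<rho> * M j) \<noteq> 0} \<noteq> {}" by blast
next
  fix x assume "x \<in> {confidence d n \<eta> \<rho> j M | M.
      locc_measurement d n M \<and> tr (avg_state d n \<eta> \<rho> * M j) \<noteq> 0}"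
  then obtain M where M: "locc_measurement d n M" "tr (avg_state d n \<eta> \<rho> * M j) \<noteq> 0"
    and x: "x = confidence d n \<eta> \<rho> j M" by blast
  obtain M' where M': "locc_realizes n d M'" "\<forall>i\<in>{0..n}. M i = M' i"
    using M(1) by (auto simp: locc_measurement_def)
  have "M j = M' j" using M'(2) j by simp
  then have sep: "M j \<in> SEP d" using locc_realizes_SEP[OF M'(1) dims] by simp
  \<comment> \<open>For the constant 0 the hypothesis of \<open>confidence_le\<close> is block
    positivity of \<open>W j\<close> tested on the separable \<open>M j\<close>.\<close>
  show "x \<le> lam j / (Lam - \<epsilon>)"
    using confidence_le[OF j, of M 0, OF SEP_psd[OF sep] M(2)] block_positive_SEP[OF W_block[OF j] sep]
    by (simp add: x)
qed

end

theorem mainTheorem7: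
  fixes d :: "nat list" and n :: nat
    and W :: "nat \<Rightarrow> complex mat" and Wsum :: "complex mat"
    and \<epsilon> :: real and lam :: "nat \<Rightarrow> real" and Lam :: real
    and \<eta> :: "nat \<Rightarrow> real" and \<rho> :: "nat \<Rightarrow> complex mat" and \<delta> :: "nat \<Rightarrow> real"
  assumes parties: "2 \<le> length d" "\<forall>k<length d. 0 < d ! k"
    and W: "\<forall>i\<in>{1..n}. W i \<in> witnesses d"
    and Wsum: "Wsum = msum (prod_list d) W {1..n}"
    and \<epsilon>: "\<epsilon> = min_eig Wsum" "0 < \<epsilon>"
    and lam: "\<forall>i\<in>{1..n}. lam i = max_eig (W i)"
    and Lam: "Lam = (\<Sum>i\<in>{1..n}. lam i)"
    and \<eta>: "\<forall>i\<in>{1..n}. \<eta> i =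
        Re (tr (complex_of_real (lam i) \<cdot>\<^sub>m Wsum - complex_of_real \<epsilon> \<cdot>\<^sub>m W i)) /
        Re (tr (complex_of_real Lam \<cdot>\<^sub>m Wsum - complex_of_real \<epsilon> \<cdot>\<^sub>m Wsum))"
    and \<rho>: "\<forall>i\<in>{1..n}. \<rho> i =
        (1 / tr (complex_of_real (lam i) \<cdot>\<^sub>m Wsum - complex_of_real \<epsilon> \<cdot>\<^sub>m W i)) \<cdot>\<^sub>m
          (complex_of_real (lam i) \<cdot>\<^sub>m Wsum - complex_of_real \<epsilon> \<cdot>\<^sub>m W i)"
    and \<delta>: "\<forall>j\<in>{1..n}. \<delta> j = \<bar>min_eig (minv (psd_sqrt Wsum) * W j * minv (psd_sqrt Wsum))\<bar>"
  shows "ensemble d n \<eta> \<rho> \<and>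
    (\<forall>j\<in>{1..n}.
       min_eig (minv (psd_sqrt Wsum) * W j * minv (psd_sqrt Wsum)) < 0 \<and>
       Q_bound d n \<eta> \<rho> j \<le> lam j / (Lam - \<epsilon>) \<and>
       lam j / (Lam - \<epsilon>) < max_confidence d n \<eta> \<rho> j \<and>
       max_confidence d n \<eta> \<rho> j = (lam j + \<epsilon> * \<delta> j) / (Lam - \<epsilon>) \<and>
       nonlocal_confidence d n \<eta> \<rho> j \<and>
       (weakly_optimal d (W j) \<longrightarrow> Q_bound d n \<eta> \<rho> j = lam j / (Lam - \<epsilon>)))"
proof -
  interpret witness_ensemble d n W Wsum \<epsilon> lam Lam \<eta> \<rho>
    by (unfold_locales; fact)
  have main: "min_eig (A j) < 0 \<and> Q_bound d n \<eta> \<rho> j \<le> lam j / (Lam - \<epsilon>) \<and>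
      lam j / (Lam - \<epsilon>) < max_confidence d n \<eta> \<rho> j \<and>
      max_confidence d n \<eta> \<rho> j = (lam j + \<epsilon> * \<delta> j) / (Lam - \<epsilon>) \<and>
      nonlocal_confidence d n \<eta> \<rho> j \<and>
      (weakly_optimal d (W j) \<longrightarrow> Q_bound d n \<eta> \<rho> j = lam j / (Lam - \<epsilon>))"
    if j: "j \<in> {1..n}" for j
  proof -
    have neg: "min_eig (A j) < 0" by (rule min_eig_A_neg[OF j])
    then have "\<delta> j = - min_eig (A j)" using \<delta> j by simp
    then have max: "max_confidence d n \<eta> \<rho> j = (lam j + \<epsilon> * \<delta> j) / (Lam - \<epsilon>)"
      using max_confidence_eq[OF j] by simp
    have "0 < \<epsilon> * \<delta> j" using neg \<epsilon>(2) \<open>\<delta> j = - min_eig (A j)\<close> by (intro mult_pos_pos) auto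
    then have gt: "lam j / (Lam - \<epsilon>) < max_confidence d n \<eta> \<rho> j"
      unfolding max using Lam_gt by (intro divide_strict_right_mono) auto
    then have "nonlocal_confidence d n \<eta> \<rho> j"
      unfolding nonlocal_confidence_def using locc_max_confidence_le[OF j] by linarith
    then show ?thesis
      using neg max gt Q_bound_props(1)[OF j] Q_bound_weakly_optimal[OF j] by blast
  qed
  show ?thesis using ensemble main by blast
qed

end
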